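(* Let $\{\mathbb{L}_i : i\in I\}$ be a set of lattice-based algebras of the same type, and let $\beta I$ be the set of all ultrafilters on $I$. Then there is an isomorphism of lattice-based algebras $$\Big(\prod_{i\in I}\mathbb{L}_i\Big)^\sigma\;\cong\;\prod_{U\in\beta I}\Big(\prod_U\mathbb{L}_i\Big)^\sigma$$ between the canonical extension of the direct product of the $\mathbb{L}_i$ and the direct product of the canonical extensions of all ultraproducts $\prod_U\mathbb{L}_i$ of the $\mathbb{L}_i$.
   Context: All lattices are bounded and homomorphisms preserve $0,1$. A completion of a lattice $\mathbb{L}$ is a complete lattice $\mathbb{C}$ with a lattice embedding $e\colon\mathbb{L}\to\mathbb{C}$; elements of $\mathbb{C}$ that are joins (resp. meets) of elements of $e[\mathbb{L}]$ are called open (resp. closed). The completion is dense if every element of $\mathbb{C}$ is a join of closed elements and a meet of open elements; compact if for all $S,T\subseteq\mathbb{L}$ with $\bigwedge e[S]\le\bigvee e[T]$ there are finite $S'\subseteq S$, $T'\subseteq T$ with $\bigwedge S'\le\bigvee T'$. The canonical extension $\mathbb{L}^\sigma$ is a dense compact completion (unique up to unique isomorphism over $\mathbb{L}$); regard $\mathbb{L}\subseteq\mathbb{L}^\sigma$. For a map $f\colon\mathbb{L}\to\mathbb{M}$, $f^\sigma\colon\mathbb{L}^\sigma\to\mathbb{M}^\sigma$ is $f^\sigma x=\bigvee\{\bigwedge\{fa: a\in\mathbb{L},\ p\le a\le q\}: p\text{ closed},\ q\text{ open},\ p\le x\le q\}$. A lattice-based algebra is a bounded lattice with additional finitary operations;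 its canonical extension is the canonical extension of the lattice equipped with the operations $f^\sigma$ (identifying $(\mathbb{L}^n)^\sigma$ with $(\mathbb{L}^\sigma)^n$). For an ultrafilter $U$ on $I$, the ultraproduct $\prod_U\mathbb{L}_i$ is the quotient of $\prod_I\mathbb{L}_i$ by the congruence $f\sim_U g$ iff $\{i: f(i)=g(i)\}\in U$. *)

theory Defs
  imports Complex_Main "HOL-Algebra.Complete_Lattice"
begin

section \<open>Lattice-based algebras\<close>

text \<open>
  A similarity type is a set \<open>F\<close> of operation symbols with an arity function \<open>ar\<close>; it lists
  only the operations added to the bounded lattice structure. An \<open>n\<close>-ary operation is a
  function on lists, of interest only on lists of length \<open>n\<close> over the carrier.
\<close>

record ('a, 'f) lba = "'a gorder" +
  oper :: "'f \<Rightarrow> 'a list \<Rightarrow> 'a"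

definition power_lattice :: "nat \<Rightarrow> ('a, 'm) gorder_scheme \<Rightarrow> 'a list gorder" where
  "power_lattice n L =
    \<lparr> carrier = {xs. length xs = n \<and> set xs \<subseteq> carrier L},
      eq = (=),
      le = list_all2 (le L) \<rparr>"

locale lattice_based_algebra = bounded_lattice L
  for F :: "'f set" and ar :: "'f \<Rightarrow> nat" and L :: "('a, 'f) lba" (structure) +
  assumes oper_closed:
    "\<lbrakk>f \<in> F; xs \<in> carrier (power_lattice (ar f) L)\<rbrakk> \<Longrightarrow> oper L f xs \<in> carrier L"

definition bounded_lattice_hom ::
  "('a, 'm) gorder_scheme \<Rightarrow> ('b, 'n) gorder_scheme \<Rightarrow> ('a \<Rightarrow> 'b) \<Rightarrow> bool" where
  "bounded_lattice_hom L M h \<longleftrightarrow>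
    h \<in> carrier L \<rightarrow> carrier M \<and> join_pres L M h \<and> meet_pres L M h \<and>
    h \<bottom>\<^bsub>L\<^esub> = \<bottom>\<^bsub>M\<^esub> \<and> h \<top>\<^bsub>L\<^esub> = \<top>\<^bsub>M\<^esub>"

definition lattice_embedding ::
  "('a, 'm) gorder_scheme \<Rightarrow> ('b, 'n) gorder_scheme \<Rightarrow> ('a \<Rightarrow> 'b) \<Rightarrow> bool" where
  "lattice_embedding L M h \<longleftrightarrow> bounded_lattice_hom L M h \<and> inj_on h (carrier L)"

definition lba_hom ::
  "'f set \<Rightarrow> ('f \<Rightarrow> nat) \<Rightarrow> ('a, 'f) lba \<Rightarrow> ('b, 'f) lba \<Rightarrow> ('a \<Rightarrow> 'b) \<Rightarrow> bool" where
  "lba_hom F ar L M h \<longleftrightarrow>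
    bounded_lattice_hom L M h \<and>
    (\<forall>f\<in>F. \<forall>xs\<in>carrier (power_lattice (ar f) L). h (oper L f xs) = oper M f (map h xs))"

definition lba_iso ::
  "'f set \<Rightarrow> ('f \<Rightarrow> nat) \<Rightarrow> ('a, 'f) lba \<Rightarrow> ('b, 'f) lba \<Rightarrow> ('a \<Rightarrow> 'b) \<Rightarrow> bool" where
  "lba_iso F ar L M h \<longleftrightarrow> lba_hom F ar L M h \<and> bij_betw h (carrier L) (carrier M)"


section \<open>Canonical extensions\<close>

definition open_elements ::
  "('a, 'm) gorder_scheme \<Rightarrow> ('c, 'n) gorder_scheme \<Rightarrow> ('a \<Rightarrow> 'c) \<Rightarrow> 'c set" where
  "open_elements L C e = {\<Squnion>\<^bsub>C\<^esub> (e ` S) | S. S \<subseteq> carrier L}"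

definition closed_elements ::
  "('a, 'm) gorder_scheme \<Rightarrow> ('c, 'n) gorder_scheme \<Rightarrow> ('a \<Rightarrow> 'c) \<Rightarrow> 'c set" where
  "closed_elements L C e = {\<Sqinter>\<^bsub>C\<^esub> (e ` S) | S. S \<subseteq> carrier L}"

locale dense_compact_completion =
  L: bounded_lattice L + C: complete_lattice C
  for L :: "('a, 'm) gorder_scheme" and C :: "('c, 'n) gorder_scheme" and e :: "'a \<Rightarrow> 'c" +
  assumes embedding: "lattice_embedding L C e"
    and dense_closed:
      "x \<in> carrier C \<Longrightarrow> \<exists>P. P \<subseteq> closed_elements L C e \<and> x = \<Squnion>\<^bsub>C\<^esub> P"
    and dense_open:
      "x \<in> carrier C \<Longrightarrow> \<exists>Q. Q \<subseteq> open_elements L C e \<and> x = \<Sqinter>\<^bsub>C\<^esub> Q"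
    and compact:
      "\<lbrakk>S \<subseteq> carrier L; T \<subseteq> carrier L; \<Sqinter>\<^bsub>C\<^esub> (e ` S) \<sqsubseteq>\<^bsub>C\<^esub> \<Squnion>\<^bsub>C\<^esub> (e ` T)\<rbrakk> \<Longrightarrow>
        \<exists>S' T'. finite S' \<and> S' \<subseteq> S \<and> finite T' \<and> T' \<subseteq> T \<and> \<Sqinter>\<^bsub>L\<^esub> S' \<sqsubseteq>\<^bsub>L\<^esub> \<Squnion>\<^bsub>L\<^esub> T'"

text \<open>
  The extension of \<open>f: L \<rightarrow> M\<close> to \<open>C \<rightarrow> D\<close>, where \<open>C\<close>, \<open>D\<close> with embeddings \<open>e\<close>, \<open>d\<close> are the
  canonical extensions of \<open>L\<close>, \<open>M\<close>.
\<close>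

definition sigma_extension ::
  "('a, 'k) gorder_scheme \<Rightarrow> ('c, 'l) gorder_scheme \<Rightarrow> ('a \<Rightarrow> 'c) \<Rightarrow>
   ('d, 'm) gorder_scheme \<Rightarrow> ('b \<Rightarrow> 'd) \<Rightarrow> ('a \<Rightarrow> 'b) \<Rightarrow> 'c \<Rightarrow> 'd" where
  "sigma_extension L C e D d f x =
    \<Squnion>\<^bsub>D\<^esub> {\<Sqinter>\<^bsub>D\<^esub> {d (f a) | a. a \<in> carrier L \<and> p \<sqsubseteq>\<^bsub>C\<^esub> e a \<and> e a \<sqsubseteq>\<^bsub>C\<^esub> q} | p q.
        p \<in> closed_elements L C e \<and> q \<in> open_elements L C e \<and> p \<sqsubseteq>\<^bsub>C\<^esub> x \<and> x \<sqsubseteq>\<^bsub>C\<^esub> q}"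

text \<open>
  The canonical extension of the power \<open>L\<^sup>n\<close> is taken to be \<open>C\<^sup>n\<close> with the componentwise
  embedding \<open>map e\<close>.
\<close>

locale canonical_extension =
  lattice_based_algebra F ar L + dense_compact_completion L C e
  for F :: "'f set" and ar :: "'f \<Rightarrow> nat"
    and L :: "('a, 'f) lba" and C :: "('c, 'f) lba" and e :: "'a \<Rightarrow> 'c" +
  assumes oper_eq:
    "\<lbrakk>f \<in> F; xs \<in> carrier (power_lattice (ar f) C)\<rbrakk> \<Longrightarrow>
      oper C f xs =
        sigma_extension (power_lattice (ar f) L) (power_lattice (ar f) C) (map e) C e (oper L f) xs"


section \<open>Products and ultraproducts\<close>

definition product_algebra :: "'i set \<Rightarrow> ('i \<Rightarrow> ('a, 'f) lba) \<Rightarrow> ('i \<Rightarrow> 'a, 'f) lba" where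
  "product_algebra I L =
    \<lparr> carrier = (\<Pi>\<^sub>E i\<in>I. carrier (L i)),
      eq = (=),
      le = (\<lambda>x y. \<forall>i\<in>I. x i \<sqsubseteq>\<^bsub>L i\<^esub> y i),
      oper = (\<lambda>f xs. \<lambda>i\<in>I. oper (L i) f (map (\<lambda>x. x i) xs)) \<rparr>"

text \<open>
  The quotient of \<open>A\<close> by a congruence \<open>\<theta>\<close>. A class \<open>X\<close> is below \<open>Y\<close> in the quotient lattice iff
  the meet of \<open>X\<close> and \<open>Y\<close>, which is the class of \<open>x \<sqinter> y\<close> for representatives \<open>x\<close>, \<open>y\<close>, is \<open>X\<close>.
\<close>

definition quotient_algebra :: "('a, 'f) lba \<Rightarrow> ('a \<times> 'a) set \<Rightarrow> ('a set, 'f) lba" where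
  "quotient_algebra A \<theta> =
    \<lparr> carrier = carrier A // \<theta>,
      eq = (=),
      le = (\<lambda>X Y. \<exists>x\<in>X. \<exists>y\<in>Y. x \<sqinter>\<^bsub>A\<^esub> y \<in> X),
      oper = (\<lambda>f Xs. \<Union> {\<theta> `` {oper A f xs} | xs. list_all2 (\<in>) xs Xs}) \<rparr>"

text \<open>
  Ultrafilters on \<open>I\<close>, as filters of the library: \<open>A \<subseteq> I\<close> is a member of \<open>U\<close> iff
  \<open>eventually (\<lambda>i. i \<in> A) U\<close>. The condition \<open>U \<le> principal I\<close> says that \<open>I\<close> is a member.
\<close>

definition ultrafilters :: "'i set \<Rightarrow> 'i filter set" where
  "ultrafilters I =
    {U. U \<noteq> bot \<and> U \<le> principal I \<and>
        (\<forall>A\<subseteq>I. eventually (\<lambda>i. i \<in> A) U \<or> eventually (\<lambda>i. i \<in> I - A) U)}"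

definition ultraproduct_rel ::
  "'i set \<Rightarrow> ('i \<Rightarrow> ('a, 'f) lba) \<Rightarrow> 'i filter \<Rightarrow> (('i \<Rightarrow> 'a) \<times> ('i \<Rightarrow> 'a)) set" where
  "ultraproduct_rel I L U =
    {(x, y). x \<in> carrier (product_algebra I L) \<and> y \<in> carrier (product_algebra I L) \<and>
             eventually (\<lambda>i. i \<in> {i\<in>I. x i = y i}) U}"

definition ultraproduct ::
  "'i set \<Rightarrow> ('i \<Rightarrow> ('a, 'f) lba) \<Rightarrow> 'i filter \<Rightarrow> (('i \<Rightarrow> 'a) set, 'f) lba" where
  "ultraproduct I L U = quotient_algebra (product_algebra I L) (ultraproduct_rel I L U)"

end

theory Submission
  imports Defs
begin

text \<open>
  Write \<open>P\<close> for the product of the \<open>L\<^sub>i\<close> and \<open>E\<close> for the product of the canonical extensions of all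
  ultraproducts. The map \<open>j: P \<rightarrow> E\<close> whose component at \<open>U\<close> is the class modulo \<open>U\<close> makes \<open>E\<close> a
  dense compact completion of \<open>P\<close>. It is dense because an element of \<open>E\<close> that is closed at one
  coordinate \<open>U\<close> and bottom elsewhere is closed: restrict elements of \<open>P\<close> to members of \<open>U\<close> and
  set them to bottom off these. It is compact because the space of ultrafilters is. By uniqueness of
  dense compact completions there is an order isomorphism of the canonical extension of \<open>P\<close> with
  \<open>E\<close> over \<open>P\<close>.

  The operations agree coordinatewise because closed \<open>p\<close> and open \<open>q\<close> lift from a coordinate
  \<open>U\<close> to \<open>E\<close>, and each element of the ultraproduct between \<open>p U\<close> and \<open>q U\<close> has a
  representative between \<open>p\<close> and \<open>q\<close>: by compactness any representative lies between on a member
  of \<open>U\<close>, and off that set it can be replaced by some element of \<open>P\<close> between \<open>p\<close> and \<open>q\<close>.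
\<close>


text \<open>The principal ultrafilters alone make \<open>j\<close> injective, but the product over
  them is in general not compact: for infinite \<open>I\<close> and nontrivial factors, the elements
  of \<open>P\<close> that are top on a cofinite set and bottom elsewhere have meet bottom at every
  principal ultrafilter, while no finite meet of them is bottom. Adding the nonprincipal
  ultrafilters restores compactness. An element of \<open>P\<close> is then visible at a coordinate
  \<open>U\<close> only up to sets in \<open>U\<close>, which is why the constructions glue two
  elements of \<open>P\<close> along a subset of \<open>I\<close>. The added operations need not be
  monotone. Their extension at \<open>x\<close> is computed from two-sided intervals, and an order
  isomorphism over \<open>P\<close> has to be supplemented by an exact comparison of these intervals
  at each coordinate \<open>U\<close>. It is made for a single argument first: closed and open
  elements of a power are coordinatewise, so the conditions pass to every arity.\<close>

section \<open>Ultrafilters\<close>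

text \<open>Zorn's lemma on the proper filters finer than \<open>G\<close>, each encoded as its set
  of predicates: a filter that is smaller in the library order has more predicates, so minimal
  filters become maximal sets.\<close>

lemma ultrafilter_below:
  assumes "G \<noteq> bot" "G \<le> principal I"
  obtains U where "U \<in> ultrafilters I" "U \<le> G"
proof -
  have is_filter: "is_filter (\<lambda>P. eventually P H)" for H :: "'a filter"
    unfolding eventually_def by (rule is_filter_Rep_filter)
  let ?A = "{S. is_filter (\<lambda>P. P \<in> S) \<and> (\<lambda>_. False) \<notin> S \<and> {P. eventually P G} \<subseteq> S}"
  have in_A: "{P. eventually P H} \<in> ?A" if H: "H \<noteq> bot" "H \<le> G" for H
  proof -
    have "{P. eventually P G} \<subseteq> {P. eventually P H}" using filter_leD[OF H(2)] by blast
    with H(1) is_filter[of H] show ?thesis by (simp add: trivial_limit_def)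
  qed
  have "?A \<noteq> {}" using in_A[OF assms(1) order_refl] by (rule ex_in_conv[THEN iffD1, OF exI])
  moreover have "\<Union>\<C> \<in> ?A" if ne: "\<C> \<noteq> {}" and chain: "subset.chain ?A \<C>" for \<C>
  proof -
    have sub: "\<C> \<subseteq> ?A" using chain by (simp add: subset_chain_def)
    then have filter: "is_filter (\<lambda>P. P \<in> X)" if "X \<in> \<C>" for X using that by blast
    have "is_filter (\<lambda>P. P \<in> \<Union>\<C>)"
    proof
      obtain X where X: "X \<in> \<C>" using ne by blast
      show "(\<lambda>_. True) \<in> \<Union>\<C>"
        using is_filter.True[OF filter[OF X]] by (rule UnionI[OF X])
    next
      fix P Q :: "'a \<Rightarrow> bool" assume "P \<in> \<Union>\<C>" "Q \<in> \<Union>\<C>"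
      then obtain X Y where "X \<in> \<C>" "Y \<in> \<C>" "P \<in> X" "Q \<in> Y" by blast
      \<comment> \<open>The chain condition puts both predicates into one member of the chain, which
        then contains their conjunction.\<close>
      moreover from chain have "X \<subseteq> Y \<or> Y \<subseteq> X"
        using \<open>X \<in> \<C>\<close> \<open>Y \<in> \<C>\<close> by (simp add: subset_chain_def)
      ultimately obtain Z where Z: "Z \<in> \<C>" "P \<in> Z" "Q \<in> Z" by blast
      show "(\<lambda>x. P x \<and> Q x) \<in> \<Union>\<C>"
        using is_filter.conj[OF filter[OF Z(1)], of P Q] Z(2,3) by (intro UnionI[OF Z(1)])
    next
      fix P Q :: "'a \<Rightarrow> bool" assume PQ: "\<forall>x. P x \<longrightarrow> Q x" and "P \<in> \<Union>\<C>"
      then obtain Z where Z: "Z \<in> \<C>" "P \<in> Z" by blast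
      show "Q \<in> \<Union>\<C>"
        using is_filter.mono[OF filter[OF Z(1)], of P Q] PQ Z(2) by (intro UnionI[OF Z(1)])
    qed
    moreover have "(\<lambda>_. False) \<notin> X" "{P. eventually P G} \<subseteq> X" if "X \<in> \<C>" for X
      using that sub by blast+
    with ne have "(\<lambda>_. False) \<notin> \<Union>\<C>" "{P. eventually P G} \<subseteq> \<Union>\<C>" by blast+
    ultimately show ?thesis by simp
  qed
  ultimately have "\<exists>M\<in>?A. \<forall>X\<in>?A. M \<subseteq> X \<longrightarrow> X = M" by (rule subset_Zorn_nonempty)
  then obtain M where M: "M \<in> ?A" and max: "\<forall>X\<in>?A. M \<subseteq> X \<longrightarrow> X = M" by (rule bexE)
  define U where "U = Abs_filter (\<lambda>P. P \<in> M)"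
  have ev: "eventually P U \<longleftrightarrow> P \<in> M" for P
    using M by (simp add: U_def eventually_Abs_filter)
  have "U \<noteq> bot" using M by (simp add: trivial_limit_def ev)
  have "U \<le> G" using M by (simp add: le_filter_def ev subset_iff)
  have ultra: "eventually P U \<or> eventually (\<lambda>i. \<not> P i) U" for P
  proof (rule disjCI)
    assume *: "\<not> eventually (\<lambda>i. \<not> P i) U"
    \<comment> \<open>Adjoining \<open>P\<close> keeps the filter proper because the complement of
      \<open>P\<close> is not in \<open>U\<close>; maximality of \<open>M\<close> then says that
      \<open>P\<close> was there already.\<close>
    let ?V = "inf U (principal {i. P i})"
    have "?V \<noteq> bot" using * by (simp add: trivial_limit_def eventually_inf_principal)
    moreover have "?V \<le> G" using \<open>U \<le> G\<close> by (rule le_infI1)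
    ultimately have "{Q. eventually Q ?V} \<in> ?A" by (rule in_A)
    moreover have "M \<subseteq> {Q. eventually Q ?V}"
      using filter_leD[OF inf_le1[of U]] by (simp add: subset_iff flip: ev)
    ultimately have "{Q. eventually Q ?V} = M" by (rule max[rule_format])
    moreover have "eventually P ?V" by (simp add: eventually_inf_principal)
    ultimately show "eventually P U" unfolding ev by (metis mem_Collect_eq)
  qed
  have "U \<le> principal I" using \<open>U \<le> G\<close> assms(2) by (rule order_trans)
  then have "eventually (\<lambda>i. i \<in> I) U" by (simp add: le_principal)
  have "eventually (\<lambda>i. i \<in> A) U \<or> eventually (\<lambda>i. i \<in> I - A) U" for A
    using ultra[of "\<lambda>i. i \<in> A"] eventually_conj[OF \<open>eventually (\<lambda>i. i \<in> I) U\<close>, of "\<lambda>i. i \<notin> A"]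
    by (simp only: Diff_iff) blast
  with \<open>U \<noteq> bot\<close> \<open>U \<le> principal I\<close> have "U \<in> ultrafilters I"
    by (simp add: ultrafilters_def)
  with \<open>U \<le> G\<close> show thesis using that by blast
qed

text \<open>Compactness of the space of ultrafilters: if no finite subfamily covered
  \<open>I\<close>, the complements \<open>I - A\<close> would have the finite intersection
  property, and an ultrafilter containing all of them would contain no member of the family.\<close>

lemma ultrafilters_compact:
  assumes "\<And>U. U \<in> ultrafilters I \<Longrightarrow> \<exists>A\<in>\<A>. eventually (\<lambda>i. i \<in> A) U"
  obtains \<B> where "\<B> \<subseteq> \<A>" "finite \<B>" "I \<subseteq> \<Union>\<B>"
proof (rule ccontr)
  assume "\<not> thesis"
  then have no: "\<not> I \<subseteq> \<Union>\<B>" if "\<B> \<subseteq> \<A>" "finite \<B>" for \<B>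
    using that \<open>\<And>\<B>. \<lbrakk>\<B> \<subseteq> \<A>; finite \<B>; I \<subseteq> \<Union>\<B>\<rbrakk> \<Longrightarrow> thesis\<close> by blast
  \<comment> \<open>The extra index \<open>{}\<close> contributes \<open>principal I\<close>, so the
    infimum lies below \<open>principal I\<close> even for an empty family.\<close>
  let ?G = "INF A\<in>insert {} \<A>. principal (I - A)"
  have "(INF A\<in>X. principal (I - A)) \<noteq> bot" if "X \<subseteq> insert {} \<A>" "finite X" for X
  proof -
    have "\<not> I \<subseteq> \<Union>(X - {{}})" using that by (intro no) auto
    then have "(\<Inter>A\<in>X. I - A) \<noteq> {}" by blast
    with that(2) show ?thesis by (simp add: INF_principal_finite principal_eq_bot_iff)
  qed
  then have "?G \<noteq> bot" by (rule INF_filter_not_bot)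
  moreover have "?G \<le> principal I"
    by (rule INF_lower2[of "{}"]) auto
  ultimately obtain U where U: "U \<in> ultrafilters I" "U \<le> ?G" by (rule ultrafilter_below)
  from assms[OF U(1)] obtain A where A: "A \<in> \<A>" "eventually (\<lambda>i. i \<in> A) U" by blast
  have "U \<le> principal (I - A)"
    using U(2) A(1) by (meson INF_lower insertI2 order_trans)
  then have "eventually (\<lambda>i. i \<in> I - A) U" by (simp add: le_principal)
  from eventually_conj[OF this A(2)] have "eventually (\<lambda>_. False) U"
    by (rule eventually_mono) auto
  with U(1) show False by (simp add: ultrafilters_def trivial_limit_def)
qed

lemma ultrafilter_proper:
  "U \<in> ultrafilters I \<Longrightarrow> U \<noteq> bot"
  by (simp add: ultrafilters_def)

lemma ultrafilter_eventually_in: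
  "U \<in> ultrafilters I \<Longrightarrow> eventually (\<lambda>i. i \<in> I) U"
  by (simp add: ultrafilters_def le_principal)

text \<open>The definition of \<open>ultrafilters\<close> decides only subsets of \<open>I\<close>;
  a predicate on the whole type is decided through its restriction to \<open>I\<close>.\<close>

lemma ultrafilter_eventually_not_iff:
  assumes "U \<in> ultrafilters I"
  shows "eventually (\<lambda>i. \<not> P i) U \<longleftrightarrow> \<not> eventually P U"
proof
  assume "eventually (\<lambda>i. \<not> P i) U"
  with ultrafilter_proper[OF assms] show "\<not> eventually P U"
    unfolding not_eventually by (rule eventually_frequently)
next
  from assms have "\<forall>A\<subseteq>I. eventually (\<lambda>i. i \<in> A) U \<or> eventually (\<lambda>i. i \<in> I - A) U"
    unfolding ultrafilters_def by (elim CollectE conjE)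
  then have "eventually (\<lambda>i. i \<in> {i\<in>I. P i}) U \<or> eventually (\<lambda>i. i \<in> I - {i\<in>I. P i}) U"
    by (elim allE impE) (rule Collect_restrict)
  moreover assume "\<not> eventually P U"
  have "\<not> eventually (\<lambda>i. i \<in> {i\<in>I. P i}) U"
  proof
    assume "eventually (\<lambda>i. i \<in> {i\<in>I. P i}) U"
    then have "eventually P U" by (rule eventually_mono) simp
    with \<open>\<not> eventually P U\<close> show False by (rule notE)
  qed
  ultimately have "eventually (\<lambda>i. i \<in> I - {i\<in>I. P i}) U" by (elim disjE) (erule notE)
  then show "eventually (\<lambda>i. \<not> P i) U" by (rule eventually_mono) simp
qed

text \<open>A predicate that distinguishes \<open>U\<close> from \<open>V\<close> may hold in
  \<open>V\<close> instead of \<open>U\<close>; its complement then does the job.\<close>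

lemma ultrafilters_separated:
  assumes "U \<in> ultrafilters I" "V \<in> ultrafilters I" "U \<noteq> V"
  obtains A where "eventually (\<lambda>i. i \<in> A) U" "\<not> eventually (\<lambda>i. i \<in> A) V"
proof -
  from assms(3) obtain P where "eventually P U \<noteq> eventually P V"
    by (auto simp: filter_eq_iff)
  then have "(eventually P U \<and> \<not> eventually P V) \<or>
      (eventually (\<lambda>i. \<not> P i) U \<and> \<not> eventually (\<lambda>i. \<not> P i) V)"
    using assms(1,2) by (auto simp: ultrafilter_eventually_not_iff)
  then show thesis using that[of "{i. P i}"] that[of "{i. \<not> P i}"] by auto
qed

lemma principal_ultrafilter:
  "i \<in> I \<Longrightarrow> principal {i} \<in> ultrafilters I"
  by (auto simp: ultrafilters_def principal_eq_bot_iff eventually_principal)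


section \<open>Complete lattices\<close>

lemma (in partial_order) sup_eqI: "least L s (Upper L A) \<Longrightarrow> \<Squnion>A = s"
  unfolding sup_def by (rule some_equality) (auto intro: least_unique)

lemma (in partial_order) inf_eqI: "greatest L s (Lower L A) \<Longrightarrow> \<Sqinter>A = s"
  unfolding inf_def by (rule some_equality) (auto intro: greatest_unique)

text \<open>The empty set is included, with the top as its infimum: the finite sets supplied by
  compactness may be empty.\<close>

lemma (in bounded_lattice) finite_inf_glb:
  "finite A \<Longrightarrow> A \<subseteq> carrier L \<Longrightarrow> greatest L (\<Sqinter>A) (Lower L A)"
  using top_greatest inf_eqI[of "\<top>" "{}"] finite_inf_greatest by (cases "A = {}") auto

lemma (in bounded_lattice) finite_sup_lub:
  "finite A \<Longrightarrow> A \<subseteq> carrier L \<Longrightarrow> least L (\<Squnion>A) (Upper L A)"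
  using bottom_least sup_eqI[of "\<bottom>" "{}"] finite_sup_least by (cases "A = {}") auto

lemma (in complete_lattice) bounded_lattice: "bounded_lattice L"
  by unfold_locales

lemma (in complete_lattice) dual_complete_lattice: "complete_lattice (inv_gorder L)"
proof -
  interpret dual: partial_order "inv_gorder L" by (rule dual_order)
  show ?thesis by unfold_locales (simp_all add: sup_exists inf_exists)
qed

lemma (in complete_lattice) inf_empty: "\<Sqinter>{} = \<top>"
  using weak_inf_empty by (simp add: eq_is_equal)

lemma (in complete_lattice) sup_empty: "\<Squnion>{} = \<bottom>"
  using weak_sup_empty by (simp add: eq_is_equal)

lemma (in complete_lattice) inf_mono:
  "\<lbrakk>B \<subseteq> A; A \<subseteq> carrier L\<rbrakk> \<Longrightarrow> \<Sqinter>A \<sqsubseteq> \<Sqinter>B"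
  by (intro inf_greatest) (auto intro: inf_lower)

section \<open>Order isomorphisms of complete lattices\<close>

definition order_iso ::
  "('a, 'm) gorder_scheme \<Rightarrow> ('b, 'n) gorder_scheme \<Rightarrow> ('a \<Rightarrow> 'b) \<Rightarrow> bool" where
  "order_iso L M h \<longleftrightarrow> bij_betw h (carrier L) (carrier M) \<and>
    (\<forall>x\<in>carrier L. \<forall>y\<in>carrier L. h x \<sqsubseteq>\<^bsub>M\<^esub> h y \<longleftrightarrow> x \<sqsubseteq>\<^bsub>L\<^esub> y)"

context
  fixes C :: "('a, 'm) gorder_scheme" and D :: "('b, 'n) gorder_scheme" and h :: "'a \<Rightarrow> 'b"
  assumes C: "complete_lattice C" and D: "complete_lattice D" and h: "order_iso C D h"
begin

interpretation C: complete_lattice C by (fact C)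
interpretation D: complete_lattice D by (fact D)

lemma order_iso_sup:
  assumes A: "A \<subseteq> carrier C"
  shows "h (\<Squnion>\<^bsub>C\<^esub>A) = \<Squnion>\<^bsub>D\<^esub>(h ` A)"
proof (rule sym, rule D.sup_eqI, rule least_UpperI)
  have bij: "bij_betw h (carrier C) (carrier D)"
    and le: "\<And>x y. x \<in> carrier C \<Longrightarrow> y \<in> carrier C \<Longrightarrow> h x \<sqsubseteq>\<^bsub>D\<^esub> h y \<longleftrightarrow> x \<sqsubseteq>\<^bsub>C\<^esub> y"
    using h by (auto simp: order_iso_def)
  show "h ` A \<subseteq> carrier D" "h (\<Squnion>\<^bsub>C\<^esub>A) \<in> carrier D"
    using bij A C.sup_closed[OF A] by (auto simp: bij_betw_def)
  show "x \<sqsubseteq>\<^bsub>D\<^esub> h (\<Squnion>\<^bsub>C\<^esub>A)" if "x \<in> h ` A" for x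
    using that A le C.sup_upper C.sup_closed by (smt (verit) imageE subsetD)
  show "h (\<Squnion>\<^bsub>C\<^esub>A) \<sqsubseteq>\<^bsub>D\<^esub> y" if y: "y \<in> Upper D (h ` A)" for y
  proof -
    have "y \<in> carrier D" using y by (simp add: Upper_def)
    with bij obtain z where z: "z \<in> carrier C" "y = h z" by (auto simp: bij_betw_def)
    have "x \<sqsubseteq>\<^bsub>C\<^esub> z" if "x \<in> A" for x
    proof -
      have "h x \<sqsubseteq>\<^bsub>D\<^esub> h z"
        using y z that A bij by (force simp: Upper_def bij_betw_def)
      then show ?thesis using le[of x z] z that A by blast
    qed
    with z A le show ?thesis by (simp add: C.sup_least)
  qed
qed

end

lemma order_iso_dual:
  "order_iso C D h \<Longrightarrow> order_iso (inv_gorder C) (inv_gorder D) h"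
  by (simp add: order_iso_def)

lemma order_iso_inf:
  assumes "complete_lattice C" "complete_lattice D" "order_iso C D h" "A \<subseteq> carrier C"
  shows "h (\<Sqinter>\<^bsub>C\<^esub>A) = \<Sqinter>\<^bsub>D\<^esub>(h ` A)"
  using order_iso_sup[OF complete_lattice.dual_complete_lattice[OF assms(1)]
      complete_lattice.dual_complete_lattice[OF assms(2)] order_iso_dual[OF assms(3)], of A] assms(4)
  by simp

lemma order_iso_bounded_lattice_hom:
  assumes C: "complete_lattice C" and D: "complete_lattice D" and h: "order_iso C D h"
  shows "bounded_lattice_hom C D h"
proof -
  interpret C: complete_lattice C by (fact C)
  interpret D: complete_lattice D by (fact D)
  have "h (\<Squnion>\<^bsub>C\<^esub>{x, y}) = \<Squnion>\<^bsub>D\<^esub>{h x, h y}" "h (\<Sqinter>\<^bsub>C\<^esub>{x, y}) = \<Sqinter>\<^bsub>D\<^esub>{h x, h y}"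
    if "x \<in> carrier C" "y \<in> carrier C" for x y
    using order_iso_sup[OF C D h, of "{x, y}"] order_iso_inf[OF C D h, of "{x, y}"] that
    by simp_all
  moreover have "h \<bottom>\<^bsub>C\<^esub> = \<bottom>\<^bsub>D\<^esub>" "h \<top>\<^bsub>C\<^esub> = \<top>\<^bsub>D\<^esub>"
    using order_iso_sup[OF C D h, of "{}"] order_iso_inf[OF C D h, of "{}"]
    by (simp_all add: C.inf_empty D.inf_empty C.sup_empty D.sup_empty)
  moreover have "h \<in> carrier C \<rightarrow> carrier D"
    using h by (simp add: order_iso_def bij_betw_imp_funcset)
  ultimately show ?thesis
    by (simp add: bounded_lattice_hom_def join_pres_def meet_pres_def join_def meet_def
        C.lattice_axioms D.lattice_axioms)
qed


section \<open>Dense compact completions\<close>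

lemma open_elements_dual:
  "open_elements L C e = closed_elements (inv_gorder L) (inv_gorder C) e"
  for L :: "('a, 'm) gorder_scheme" and C :: "('c, 'n) gorder_scheme"
  by (simp add: open_elements_def closed_elements_def)

text \<open>
  By compactness, the order between closed and open elements of a dense compact completion is
  determined by \<open>L\<close> alone, as \<open>finitely_below\<close>. By density, an element \<open>x\<close> is determined by the
  sets \<open>S\<close> with \<open>\<Sqinter>(e ` S) \<le> x\<close>, and the families of sets so arising are exactly the Galois
  stable ones.
\<close>

definition finitely_below :: "('a, 'm) gorder_scheme \<Rightarrow> 'a set \<Rightarrow> 'a set \<Rightarrow> bool" where
  "finitely_below L S T \<longleftrightarrow>
    (\<exists>S' T'. finite S' \<and> S' \<subseteq> S \<and> finite T' \<and> T' \<subseteq> T \<and> \<Sqinter>\<^bsub>L\<^esub> S' \<sqsubseteq>\<^bsub>L\<^esub> \<Squnion>\<^bsub>L\<^esub> T')"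

definition stable_families :: "('a, 'm) gorder_scheme \<Rightarrow> 'a set set set" where
  "stable_families L = {\<X>. \<X> = {S. S \<subseteq> carrier L \<and>
    (\<forall>T\<subseteq>carrier L. (\<forall>S'\<in>\<X>. finitely_below L S' T) \<longrightarrow> finitely_below L S T)}}"

text \<open>Density as separation gives density as joins: the join of all members of
  \<open>K\<close> below \<open>x\<close> dominates every member of \<open>K\<close> that
  \<open>x\<close> dominates, so separation puts \<open>x\<close> below it.\<close>

lemma (in complete_lattice) sup_of_lower_sets:
  assumes K: "K \<subseteq> carrier L"
    and dense: "\<And>x y. \<lbrakk>x \<in> carrier L; y \<in> carrier L; \<forall>p\<in>K. p \<sqsubseteq> x \<longrightarrow> p \<sqsubseteq> y\<rbrakk> \<Longrightarrow> x \<sqsubseteq> y"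
    and x: "x \<in> carrier L"
  shows "\<exists>P. P \<subseteq> K \<and> x = \<Squnion>P"
proof (intro exI conjI)
  let ?P = "{p\<in>K. p \<sqsubseteq> x}"
  show "?P \<subseteq> K" by blast
  have P: "?P \<subseteq> carrier L" using K by blast
  show "x = \<Squnion>?P"
  proof (rule le_antisym)
    show "x \<sqsubseteq> \<Squnion>?P" using x P sup_upper[OF P] by (intro dense) auto
    show "\<Squnion>?P \<sqsubseteq> x" using x P by (intro sup_least) auto
  qed (use x P in auto)
qed

lemma (in complete_lattice) inf_of_upper_sets:
  assumes K: "K \<subseteq> carrier L"
    and dense: "\<And>x y. \<lbrakk>x \<in> carrier L; y \<in> carrier L; \<forall>p\<in>K. y \<sqsubseteq> p \<longrightarrow> x \<sqsubseteq> p\<rbrakk> \<Longrightarrow> x \<sqsubseteq> y"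
    and x: "x \<in> carrier L"
  shows "\<exists>P. P \<subseteq> K \<and> x = \<Sqinter>P"
  using complete_lattice.sup_of_lower_sets[OF dual_complete_lattice, of K x] assms by simp

section \<open>The embedding, finite bounds and duality\<close>

context dense_compact_completion
begin

lemma e_closed [simp]: "a \<in> carrier L \<Longrightarrow> e a \<in> carrier C"
  using embedding by (auto simp: lattice_embedding_def bounded_lattice_hom_def)

lemma image_e_closed [simp]: "S \<subseteq> carrier L \<Longrightarrow> e ` S \<subseteq> carrier C"
  by auto

lemma e_meet: "\<lbrakk>a \<in> carrier L; b \<in> carrier L\<rbrakk> \<Longrightarrow> e (a \<sqinter>\<^bsub>L\<^esub> b) = e a \<sqinter>\<^bsub>C\<^esub> e b"
  and e_join: "\<lbrakk>a \<in> carrier L; b \<in> carrier L\<rbrakk> \<Longrightarrow> e (a \<squnion>\<^bsub>L\<^esub> b) = e a \<squnion>\<^bsub>C\<^esub> e b"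
  and e_top: "e \<top>\<^bsub>L\<^esub> = \<top>\<^bsub>C\<^esub>"
  and e_bottom: "e \<bottom>\<^bsub>L\<^esub> = \<bottom>\<^bsub>C\<^esub>"
  and e_inj: "inj_on e (carrier L)"
  using embedding
  by (auto simp: lattice_embedding_def bounded_lattice_hom_def meet_pres_def join_pres_def)

lemma e_le_iff:
  assumes "a \<in> carrier L" "b \<in> carrier L"
  shows "e a \<sqsubseteq>\<^bsub>C\<^esub> e b \<longleftrightarrow> a \<sqsubseteq>\<^bsub>L\<^esub> b"
proof -
  have "e a \<sqsubseteq>\<^bsub>C\<^esub> e b \<longleftrightarrow> e a = e (a \<sqinter>\<^bsub>L\<^esub> b)"
    using assms by (simp add: C.le_iff_join e_meet)
  also have "\<dots> \<longleftrightarrow> a = a \<sqinter>\<^bsub>L\<^esub> b"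
    using assms by (intro inj_on_eq_iff[OF e_inj]) auto
  finally show ?thesis using assms by (simp add: L.le_iff_join)
qed

text \<open>The embedding preserves binary meets and the top, so induction on \<open>S\<close>
  reaches every finite infimum. Phrased for any lower bound \<open>z\<close>, the result applies to
  closed elements without a computation of infima in \<open>C\<close>.\<close>

lemma le_e_finite_inf:
  assumes "finite S" "S \<subseteq> carrier L" "z \<in> carrier C" "\<And>s. s \<in> S \<Longrightarrow> z \<sqsubseteq>\<^bsub>C\<^esub> e s"
  shows "z \<sqsubseteq>\<^bsub>C\<^esub> e (\<Sqinter>\<^bsub>L\<^esub> S)"
  using assms
proof (induction S)
  case empty
  then show ?case using L.inf_eqI[of "\<top>\<^bsub>L\<^esub>" "{}"] L.top_greatest by (simp add: e_top)
next
  case (insert a S)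
  have S: "is_glb L (\<Sqinter>\<^bsub>L\<^esub>S) S" "is_glb L (\<Sqinter>\<^bsub>L\<^esub>insert a S) (insert a S)"
    using insert by (auto intro!: L.finite_inf_glb)
  have a: "a \<in> carrier L" "\<Sqinter>\<^bsub>L\<^esub>S \<in> carrier L" "\<Sqinter>\<^bsub>L\<^esub>insert a S \<in> carrier L"
    using S insert.prems(1) by (blast intro: greatest_closed)+
  have "a \<sqinter>\<^bsub>L\<^esub> \<Sqinter>\<^bsub>L\<^esub>S \<sqsubseteq>\<^bsub>L\<^esub> s" if "s \<in> insert a S" for s
  proof (cases "s = a")
    case True
    with a show ?thesis by (simp add: L.meet_left)
  next
    case False
    with that insert.prems(1) S(1) have "\<Sqinter>\<^bsub>L\<^esub>S \<sqsubseteq>\<^bsub>L\<^esub> s" "s \<in> carrier L"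
      by (auto dest: greatest_Lower_below)
    with a show ?thesis by (meson L.le_trans L.meet_closed L.meet_right)
  qed
  with a S(2) have "a \<sqinter>\<^bsub>L\<^esub> \<Sqinter>\<^bsub>L\<^esub>S \<sqsubseteq>\<^bsub>L\<^esub> \<Sqinter>\<^bsub>L\<^esub>insert a S"
    by (intro greatest_le[OF S(2)] Lower_memI) auto
  with a have "e a \<sqinter>\<^bsub>C\<^esub> e (\<Sqinter>\<^bsub>L\<^esub>S) \<sqsubseteq>\<^bsub>C\<^esub> e (\<Sqinter>\<^bsub>L\<^esub>insert a S)"
    by (simp add: e_le_iff flip: e_meet)
  moreover have "z \<sqsubseteq>\<^bsub>C\<^esub> e a \<sqinter>\<^bsub>C\<^esub> e (\<Sqinter>\<^bsub>L\<^esub>S)"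
    using insert.IH insert.prems a by (intro C.meet_le) simp_all
  ultimately show ?case
    using C.le_trans[of z "e a \<sqinter>\<^bsub>C\<^esub> e (\<Sqinter>\<^bsub>L\<^esub>S)" "e (\<Sqinter>\<^bsub>L\<^esub>insert a S)"] a insert.prems(2) by simp
qed

text \<open>Reversal of both orders swaps closed with open elements and \<open>S\<close> with
  \<open>T\<close> in the compactness condition; facts about open elements then become instances of
  those about closed ones.\<close>

lemma dual: "dense_compact_completion (inv_gorder L) (inv_gorder C) e"
proof (intro dense_compact_completion.intro dense_compact_completion_axioms.intro)
  interpret L': lattice "inv_gorder L" by (rule L.dual_lattice)
  show "bounded_lattice (inv_gorder L)"
    using L.bottom_exists L.top_exists by unfold_locales auto
  show C': "complete_lattice (inv_gorder C)" by (rule C.dual_complete_lattice)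
  then interpret C': complete_lattice "inv_gorder C" .
  show "lattice_embedding (inv_gorder L) (inv_gorder C) e"
    using L'.lattice_axioms C'.lattice_axioms
    by (auto simp: lattice_embedding_def bounded_lattice_hom_def join_pres_def meet_pres_def
        e_inj e_meet e_join e_top e_bottom)
  show "\<exists>P\<subseteq>closed_elements (inv_gorder L) (inv_gorder C) e. x = \<Squnion>\<^bsub>inv_gorder C\<^esub>P"
    if "x \<in> carrier (inv_gorder C)" for x
    using dense_open[of x] that by (simp add: open_elements_dual)
  show "\<exists>Q\<subseteq>open_elements (inv_gorder L) (inv_gorder C) e. x = \<Sqinter>\<^bsub>inv_gorder C\<^esub>Q"
    if "x \<in> carrier (inv_gorder C)" for x
    using dense_closed[of x] that by (simp add: open_elements_def closed_elements_def)
  show "\<exists>S' T'. finite S' \<and> S' \<subseteq> S \<and> finite T' \<and> T' \<subseteq> T \<and>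
      \<Sqinter>\<^bsub>inv_gorder L\<^esub>S' \<sqsubseteq>\<^bsub>inv_gorder L\<^esub> \<Squnion>\<^bsub>inv_gorder L\<^esub>T'"
    if "S \<subseteq> carrier (inv_gorder L)" "T \<subseteq> carrier (inv_gorder L)"
      "\<Sqinter>\<^bsub>inv_gorder C\<^esub>(e ` S) \<sqsubseteq>\<^bsub>inv_gorder C\<^esub> \<Squnion>\<^bsub>inv_gorder C\<^esub>(e ` T)" for S T
    using compact[of T S] that by auto
qed

end

section \<open>Compactness as an equivalence\<close>

context dense_compact_completion
begin

lemma e_finite_sup_le:
  assumes "finite S" "S \<subseteq> carrier L" "z \<in> carrier C" "\<And>s. s \<in> S \<Longrightarrow> e s \<sqsubseteq>\<^bsub>C\<^esub> z"
  shows "e (\<Squnion>\<^bsub>L\<^esub> S) \<sqsubseteq>\<^bsub>C\<^esub> z"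
  using dense_compact_completion.le_e_finite_inf[OF dual, of S z] assms by simp

text \<open>Compactness is the forward direction. Backwards, the images of the finite meet and of
  the finite join lie between the closed element on the left and the open element on the
  right.\<close>

lemma compact_iff:
  assumes S: "S \<subseteq> carrier L" and T: "T \<subseteq> carrier L"
  shows "\<Sqinter>\<^bsub>C\<^esub>(e ` S) \<sqsubseteq>\<^bsub>C\<^esub> \<Squnion>\<^bsub>C\<^esub>(e ` T) \<longleftrightarrow> finitely_below L S T"
proof
  assume "finitely_below L S T"
  then obtain S' T' where *: "finite S'" "S' \<subseteq> S" "finite T'" "T' \<subseteq> T" "\<Sqinter>\<^bsub>L\<^esub>S' \<sqsubseteq>\<^bsub>L\<^esub> \<Squnion>\<^bsub>L\<^esub>T'"
    unfolding finitely_below_def by blast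
  have c: "\<Sqinter>\<^bsub>L\<^esub>S' \<in> carrier L" "\<Squnion>\<^bsub>L\<^esub>T' \<in> carrier L"
    using greatest_closed[OF L.finite_inf_glb, of S'] least_closed[OF L.finite_sup_lub, of T'] * S T
    by auto
  have "\<Sqinter>\<^bsub>C\<^esub>(e ` S) \<sqsubseteq>\<^bsub>C\<^esub> e (\<Sqinter>\<^bsub>L\<^esub>S')"
    using * S by (intro le_e_finite_inf) (auto intro!: C.inf_lower)
  moreover have "e (\<Squnion>\<^bsub>L\<^esub>T') \<sqsubseteq>\<^bsub>C\<^esub> \<Squnion>\<^bsub>C\<^esub>(e ` T)"
    using * T by (intro e_finite_sup_le) (auto intro!: C.sup_upper)
  moreover have "e (\<Sqinter>\<^bsub>L\<^esub>S') \<sqsubseteq>\<^bsub>C\<^esub> e (\<Squnion>\<^bsub>L\<^esub>T')" using * c by (simp add: e_le_iff)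
  ultimately show "\<Sqinter>\<^bsub>C\<^esub>(e ` S) \<sqsubseteq>\<^bsub>C\<^esub> \<Squnion>\<^bsub>C\<^esub>(e ` T)"
    using C.le_trans[of "\<Sqinter>\<^bsub>C\<^esub>(e ` S)" "e (\<Sqinter>\<^bsub>L\<^esub>S')" "e (\<Squnion>\<^bsub>L\<^esub>T')"]
      C.le_trans[of "\<Sqinter>\<^bsub>C\<^esub>(e ` S)" "e (\<Squnion>\<^bsub>L\<^esub>T')" "\<Squnion>\<^bsub>C\<^esub>(e ` T)"] c S T
    by simp
qed (use compact[OF S T] in \<open>simp add: finitely_below_def\<close>)

section \<open>Density and the coding of elements by subsets of \<open>L\<close>\<close>

lemma le_by_closed:
  assumes x: "x \<in> carrier C" and y: "y \<in> carrier C"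
    and le: "\<And>S. \<lbrakk>S \<subseteq> carrier L; \<Sqinter>\<^bsub>C\<^esub>(e ` S) \<sqsubseteq>\<^bsub>C\<^esub> x\<rbrakk> \<Longrightarrow> \<Sqinter>\<^bsub>C\<^esub>(e ` S) \<sqsubseteq>\<^bsub>C\<^esub> y"
  shows "x \<sqsubseteq>\<^bsub>C\<^esub> y"
proof -
  obtain P where P: "P \<subseteq> closed_elements L C e" "x = \<Squnion>\<^bsub>C\<^esub>P" using dense_closed[OF x] by blast
  have PC: "P \<subseteq> carrier C" using P(1) by (auto simp: closed_elements_def)
  have "p \<sqsubseteq>\<^bsub>C\<^esub> y" if p: "p \<in> P" for p
  proof -
    obtain S where "S \<subseteq> carrier L" "p = \<Sqinter>\<^bsub>C\<^esub>(e ` S)"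
      using subsetD[OF P(1) p] by (auto simp: closed_elements_def)
    moreover have "p \<sqsubseteq>\<^bsub>C\<^esub> x" unfolding P(2) by (rule C.sup_upper[OF PC p])
    ultimately show ?thesis using le[of S] by blast
  qed
  then show ?thesis using C.sup_least[OF PC y] P(2) by simp
qed

lemma le_by_open:
  assumes "x \<in> carrier C" "y \<in> carrier C"
    and "\<And>T. \<lbrakk>T \<subseteq> carrier L; y \<sqsubseteq>\<^bsub>C\<^esub> \<Squnion>\<^bsub>C\<^esub>(e ` T)\<rbrakk> \<Longrightarrow> x \<sqsubseteq>\<^bsub>C\<^esub> \<Squnion>\<^bsub>C\<^esub>(e ` T)"
  shows "x \<sqsubseteq>\<^bsub>C\<^esub> y"
  using dense_compact_completion.le_by_closed[OF dual, of y x] assms by simp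

text \<open>Coordinates on \<open>C\<close> that mention only subsets of \<open>L\<close>, so that
  elements of two different completions of \<open>L\<close> can be matched through them.\<close>

definition lower_family :: "'c \<Rightarrow> 'a set set" where
  "lower_family x = {S. S \<subseteq> carrier L \<and> \<Sqinter>\<^bsub>C\<^esub>(e ` S) \<sqsubseteq>\<^bsub>C\<^esub> x}"

text \<open>One polarity of the Galois connection: by density of the closed elements, the open
  elements above \<open>x\<close> can be read off \<open>lower_family x\<close>, and
  \<open>compact_iff\<close> removes \<open>C\<close> from the criterion.\<close>

lemma le_open_iff_lower_family:
  assumes "x \<in> carrier C" "T \<subseteq> carrier L"
  shows "x \<sqsubseteq>\<^bsub>C\<^esub> \<Squnion>\<^bsub>C\<^esub>(e ` T) \<longleftrightarrow> (\<forall>S\<in>lower_family x. finitely_below L S T)"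
proof
  assume *: "x \<sqsubseteq>\<^bsub>C\<^esub> \<Squnion>\<^bsub>C\<^esub>(e ` T)"
  show "\<forall>S\<in>lower_family x. finitely_below L S T"
  proof
    fix S assume S: "S \<in> lower_family x"
    with * assms have "\<Sqinter>\<^bsub>C\<^esub>(e ` S) \<sqsubseteq>\<^bsub>C\<^esub> \<Squnion>\<^bsub>C\<^esub>(e ` T)"
      using C.le_trans[of "\<Sqinter>\<^bsub>C\<^esub>(e ` S)" x "\<Squnion>\<^bsub>C\<^esub>(e ` T)"] by (simp add: lower_family_def)
    with S assms show "finitely_below L S T" by (simp add: lower_family_def compact_iff)
  qed
next
  assume "\<forall>S\<in>lower_family x. finitely_below L S T"
  with assms show "x \<sqsubseteq>\<^bsub>C\<^esub> \<Squnion>\<^bsub>C\<^esub>(e ` T)"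
    by - (rule le_by_closed, simp_all add: lower_family_def compact_iff)
qed

text \<open>The other polarity, from density of the open elements. Composing the two gives the fixed
  point equation in \<open>stable_families\<close>.\<close>

lemma closed_le_iff:
  assumes "x \<in> carrier C" "S \<subseteq> carrier L"
  shows "\<Sqinter>\<^bsub>C\<^esub>(e ` S) \<sqsubseteq>\<^bsub>C\<^esub> x \<longleftrightarrow>
    (\<forall>T\<subseteq>carrier L. x \<sqsubseteq>\<^bsub>C\<^esub> \<Squnion>\<^bsub>C\<^esub>(e ` T) \<longrightarrow> finitely_below L S T)"
proof
  assume *: "\<Sqinter>\<^bsub>C\<^esub>(e ` S) \<sqsubseteq>\<^bsub>C\<^esub> x"
  have "finitely_below L S T" if "T \<subseteq> carrier L" "x \<sqsubseteq>\<^bsub>C\<^esub> \<Squnion>\<^bsub>C\<^esub>(e ` T)" for T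
  proof -
    have "\<Sqinter>\<^bsub>C\<^esub>(e ` S) \<sqsubseteq>\<^bsub>C\<^esub> \<Squnion>\<^bsub>C\<^esub>(e ` T)"
      using assms that(1) by (intro C.le_trans[OF * that(2)]) simp_all
    then show ?thesis using assms(2) that(1) by (simp add: compact_iff)
  qed
  then show "\<forall>T\<subseteq>carrier L. x \<sqsubseteq>\<^bsub>C\<^esub> \<Squnion>\<^bsub>C\<^esub>(e ` T) \<longrightarrow> finitely_below L S T" by blast
next
  assume "\<forall>T\<subseteq>carrier L. x \<sqsubseteq>\<^bsub>C\<^esub> \<Squnion>\<^bsub>C\<^esub>(e ` T) \<longrightarrow> finitely_below L S T"
  with assms show "\<Sqinter>\<^bsub>C\<^esub>(e ` S) \<sqsubseteq>\<^bsub>C\<^esub> x"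
    by - (rule le_by_open, simp_all add: compact_iff)
qed

lemma lower_family_le_iff:
  assumes "x \<in> carrier C" "y \<in> carrier C"
  shows "lower_family x \<subseteq> lower_family y \<longleftrightarrow> x \<sqsubseteq>\<^bsub>C\<^esub> y"
proof
  assume "lower_family x \<subseteq> lower_family y"
  with assms show "x \<sqsubseteq>\<^bsub>C\<^esub> y" by - (rule le_by_closed, simp_all add: lower_family_def subset_iff)
next
  assume "x \<sqsubseteq>\<^bsub>C\<^esub> y"
  then show "lower_family x \<subseteq> lower_family y"
    using assms C.le_trans[of _ x y] by (auto simp: lower_family_def)
qed

text \<open>Density gives injectivity, and the two polarities give stability. A stable family comes
  from the join of the closed elements that it lists: an open element is above that join iff it is
  above each of them, so the stability condition returns the family itself.\<close>

lemma bij_betw_lower_family: "bij_betw lower_family (carrier C) (stable_families L)"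
  unfolding bij_betw_def
proof
  show "inj_on lower_family (carrier C)"
    by (rule inj_onI) (metis C.le_antisym lower_family_le_iff subset_refl)
  have "lower_family x \<in> stable_families L" if x: "x \<in> carrier C" for x
  proof -
    have "S \<in> lower_family x \<longleftrightarrow> S \<subseteq> carrier L \<and> (\<forall>T\<subseteq>carrier L.
        (\<forall>S'\<in>lower_family x. finitely_below L S' T) \<longrightarrow> finitely_below L S T)" for S
      using closed_le_iff[OF x, of S]
      by (simp add: lower_family_def[of x] le_open_iff_lower_family[OF x] cong: conj_cong)
    then show ?thesis unfolding stable_families_def by blast
  qed
  moreover have "\<X> \<in> lower_family ` carrier C" if "\<X> \<in> stable_families L" for \<X>
  proof
    let ?K = "(\<lambda>S. \<Sqinter>\<^bsub>C\<^esub>(e ` S)) ` \<X>"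
    have \<X>: "S \<in> \<X> \<longleftrightarrow> S \<subseteq> carrier L \<and>
        (\<forall>T\<subseteq>carrier L. (\<forall>S'\<in>\<X>. finitely_below L S' T) \<longrightarrow> finitely_below L S T)" for S
      using that unfolding stable_families_def by blast
    have \<X>L: "S \<subseteq> carrier L" if "S \<in> \<X>" for S using \<X>[of S] that by blast
    then have K: "?K \<subseteq> carrier C" by auto
    then show "\<Squnion>\<^bsub>C\<^esub>?K \<in> carrier C" by (rule C.sup_closed)
    have K_le: "\<Squnion>\<^bsub>C\<^esub>?K \<sqsubseteq>\<^bsub>C\<^esub> \<Squnion>\<^bsub>C\<^esub>(e ` T) \<longleftrightarrow> (\<forall>S\<in>\<X>. finitely_below L S T)"
      if T: "T \<subseteq> carrier L" for T
    proof -
      have eT: "\<Squnion>\<^bsub>C\<^esub>(e ` T) \<in> carrier C" using T by simp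
      have "\<Squnion>\<^bsub>C\<^esub>?K \<sqsubseteq>\<^bsub>C\<^esub> \<Squnion>\<^bsub>C\<^esub>(e ` T) \<longleftrightarrow> (\<forall>k\<in>?K. k \<sqsubseteq>\<^bsub>C\<^esub> \<Squnion>\<^bsub>C\<^esub>(e ` T))"
      proof
        assume "\<Squnion>\<^bsub>C\<^esub>?K \<sqsubseteq>\<^bsub>C\<^esub> \<Squnion>\<^bsub>C\<^esub>(e ` T)"
        then show "\<forall>k\<in>?K. k \<sqsubseteq>\<^bsub>C\<^esub> \<Squnion>\<^bsub>C\<^esub>(e ` T)"
          using C.le_trans[OF C.sup_upper[OF K] _ subsetD[OF K] C.sup_closed[OF K] eT] by (rule_tac ballI)
      qed (use C.sup_least[OF K eT] in blast)
      also have "\<dots> \<longleftrightarrow> (\<forall>S\<in>\<X>. finitely_below L S T)"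
        using \<X>L T by (simp add: compact_iff)
      finally show ?thesis .
    qed
    show "\<X> = lower_family (\<Squnion>\<^bsub>C\<^esub>?K)"
    proof (rule Set.set_eqI)
      fix S
      show "S \<in> \<X> \<longleftrightarrow> S \<in> lower_family (\<Squnion>\<^bsub>C\<^esub>?K)"
        using closed_le_iff[OF \<open>\<Squnion>\<^bsub>C\<^esub>?K \<in> carrier C\<close>, of S]
        by (simp add: lower_family_def \<X>[of S] K_le cong: conj_cong)
    qed
  qed
  ultimately show "lower_family ` carrier C = stable_families L" by blast
qed

text \<open>The right-hand side does not depend on the completion, which is why the isomorphism in
  \<open>dense_compact_completion_unique\<close> respects the embeddings of
  \<open>L\<close>.\<close>

lemma lower_family_e:
  "a \<in> carrier L \<Longrightarrow> lower_family (e a) = {S. S \<subseteq> carrier L \<and> finitely_below L S {a}}"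
  using compact_iff[of _ "{a}"] by (auto simp: lower_family_def)

section \<open>Generators and finite approximation of closed and open elements\<close>

lemma closed_element_in_carrier: "p \<in> closed_elements L C e \<Longrightarrow> p \<in> carrier C"
  unfolding closed_elements_def by auto

lemma open_element_in_carrier: "q \<in> open_elements L C e \<Longrightarrow> q \<in> carrier C"
  unfolding open_elements_def by auto

text \<open>Replaces an arbitrary generating set by the largest one, which involves no choice. The
  set built in \<open>closed_bump\<close> has classes at the coordinate \<open>U\<close> that form
  exactly this set.\<close>

lemma closed_element_eq_inf:
  assumes "p \<in> closed_elements L C e"
  shows "\<Sqinter>\<^bsub>C\<^esub>(e ` {a \<in> carrier L. p \<sqsubseteq>\<^bsub>C\<^esub> e a}) = p"
proof -
  obtain S where S: "S \<subseteq> carrier L" "p = \<Sqinter>\<^bsub>C\<^esub>(e ` S)"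
    using assms unfolding closed_elements_def by blast
  let ?A = "e ` {a \<in> carrier L. p \<sqsubseteq>\<^bsub>C\<^esub> e a}"
  have A: "?A \<subseteq> carrier C" by auto
  have p: "p \<in> carrier C" by (rule closed_element_in_carrier[OF assms])
  have "e ` S \<subseteq> ?A"
    using S(1) C.inf_lower[OF image_e_closed[OF S(1)]] unfolding S(2) by blast
  from C.inf_mono[OF this A] have "\<Sqinter>\<^bsub>C\<^esub>?A \<sqsubseteq>\<^bsub>C\<^esub> p" unfolding S(2) .
  moreover have "p \<sqsubseteq>\<^bsub>C\<^esub> \<Sqinter>\<^bsub>C\<^esub>?A" by (rule C.inf_greatest[OF A p]) blast
  ultimately show ?thesis using C.le_antisym[OF _ _ C.inf_closed[OF A] p] by blast
qed

lemma open_element_eq_sup: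
  "q \<in> open_elements L C e \<Longrightarrow> \<Squnion>\<^bsub>C\<^esub>(e ` {a \<in> carrier L. e a \<sqsubseteq>\<^bsub>C\<^esub> q}) = q"
  using dense_compact_completion.closed_element_eq_inf[OF dual, of q]
  by (simp add: open_elements_dual)

text \<open>Compactness with \<open>T = {b}\<close> returns a \<open>T'\<close> that is empty or
  \<open>{b}\<close>; its join is below \<open>b\<close> in both cases.\<close>

lemma finite_inf_below:
  assumes "S \<subseteq> carrier L" "b \<in> carrier L" "\<Sqinter>\<^bsub>C\<^esub>(e ` S) \<sqsubseteq>\<^bsub>C\<^esub> e b"
  obtains S' where "finite S'" "S' \<subseteq> S" "\<Sqinter>\<^bsub>L\<^esub> S' \<sqsubseteq>\<^bsub>L\<^esub> b"
proof -
  have "\<Sqinter>\<^bsub>C\<^esub>(e ` S) \<sqsubseteq>\<^bsub>C\<^esub> \<Squnion>\<^bsub>C\<^esub>(e ` {b})" using assms by simp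
  with compact[of S "{b}"] assms(1,2) obtain S' T' where *: "finite S'" "S' \<subseteq> S" "finite T'"
    "T' \<subseteq> {b}" "\<Sqinter>\<^bsub>L\<^esub> S' \<sqsubseteq>\<^bsub>L\<^esub> \<Squnion>\<^bsub>L\<^esub> T'" by auto
  have T': "is_lub L (\<Squnion>\<^bsub>L\<^esub>T') T'" using * assms(2) by (intro L.finite_sup_lub) auto
  then have "\<Squnion>\<^bsub>L\<^esub>T' \<sqsubseteq>\<^bsub>L\<^esub> b"
    by (rule least_le) (use *(4) assms(2) in \<open>auto intro!: Upper_memI\<close>)
  moreover have "\<Sqinter>\<^bsub>L\<^esub>S' \<in> carrier L"
    using greatest_closed[OF L.finite_inf_glb, of S'] * assms(1) by auto
  ultimately have "\<Sqinter>\<^bsub>L\<^esub>S' \<sqsubseteq>\<^bsub>L\<^esub> b"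
    using L.le_trans[OF *(5)] least_closed[OF T'] assms(2) by blast
  with * that show thesis by blast
qed

lemma finite_sup_above:
  assumes "T \<subseteq> carrier L" "b \<in> carrier L" "e b \<sqsubseteq>\<^bsub>C\<^esub> \<Squnion>\<^bsub>C\<^esub>(e ` T)"
  obtains T' where "finite T'" "T' \<subseteq> T" "b \<sqsubseteq>\<^bsub>L\<^esub> \<Squnion>\<^bsub>L\<^esub> T'"
  using dense_compact_completion.finite_inf_below[OF dual, of T b] assms by auto

text \<open>The finite meet of \<open>S'\<close> is a witness: it lies above the whole meet, and
  below the join of \<open>T'\<close> and hence below the open element. It provides the default
  values in \<open>component_interpolation\<close>.\<close>

lemma between_closed_open:
  assumes S: "S \<subseteq> carrier L" and T: "T \<subseteq> carrier L"
    and le: "\<Sqinter>\<^bsub>C\<^esub>(e ` S) \<sqsubseteq>\<^bsub>C\<^esub> \<Squnion>\<^bsub>C\<^esub>(e ` T)"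
  obtains c where "c \<in> carrier L" "\<Sqinter>\<^bsub>C\<^esub>(e ` S) \<sqsubseteq>\<^bsub>C\<^esub> e c" "e c \<sqsubseteq>\<^bsub>C\<^esub> \<Squnion>\<^bsub>C\<^esub>(e ` T)"
proof -
  from compact[OF S T le] obtain S' T' where *: "finite S'" "S' \<subseteq> S" "finite T'" "T' \<subseteq> T"
    "\<Sqinter>\<^bsub>L\<^esub>S' \<sqsubseteq>\<^bsub>L\<^esub> \<Squnion>\<^bsub>L\<^esub>T'" by blast
  have c: "\<Sqinter>\<^bsub>L\<^esub>S' \<in> carrier L" "\<Squnion>\<^bsub>L\<^esub>T' \<in> carrier L"
    using greatest_closed[OF L.finite_inf_glb, of S'] least_closed[OF L.finite_sup_lub, of T'] * S T
    by auto
  have "e (\<Squnion>\<^bsub>L\<^esub>T') \<sqsubseteq>\<^bsub>C\<^esub> \<Squnion>\<^bsub>C\<^esub>(e ` T)"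
    using * T by (intro e_finite_sup_le) (auto intro!: C.sup_upper)
  then have "e (\<Sqinter>\<^bsub>L\<^esub>S') \<sqsubseteq>\<^bsub>C\<^esub> \<Squnion>\<^bsub>C\<^esub>(e ` T)"
    using C.le_trans[of "e (\<Sqinter>\<^bsub>L\<^esub>S')" "e (\<Squnion>\<^bsub>L\<^esub>T')" "\<Squnion>\<^bsub>C\<^esub>(e ` T)"] c T *(5) by (simp add: e_le_iff)
  moreover have "\<Sqinter>\<^bsub>C\<^esub>(e ` S) \<sqsubseteq>\<^bsub>C\<^esub> e (\<Sqinter>\<^bsub>L\<^esub>S')"
    using * S by (intro le_e_finite_inf) (auto intro!: C.inf_lower)
  ultimately show thesis using that c(1) by blast
qed

end

text \<open>Both completions are coded by the same \<open>stable_families L\<close>, and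
  \<open>lower_family_le_iff\<close> makes both codings order isomorphisms onto it under
  inclusion.\<close>

lemma dense_compact_completion_unique:
  assumes C: "dense_compact_completion L C e" and D: "dense_compact_completion L D d"
  obtains h where "order_iso C D h" "\<And>a. a \<in> carrier L \<Longrightarrow> h (e a) = d a"
proof
  interpret C: dense_compact_completion L C e by (fact C)
  interpret D: dense_compact_completion L D d by (fact D)
  let ?h = "\<lambda>x. inv_into (carrier D) D.lower_family (C.lower_family x)"
  have bij: "bij_betw ?h (carrier C) (carrier D)"
    using bij_betw_trans[OF C.bij_betw_lower_family bij_betw_inv_into[OF D.bij_betw_lower_family]]
    by (simp add: comp_def)
  have h: "D.lower_family (?h x) = C.lower_family x" if "x \<in> carrier C" for x
    using that C.bij_betw_lower_family D.bij_betw_lower_family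
    by (intro f_inv_into_f) (auto simp: bij_betw_def)
  have hc: "?h x \<in> carrier D" if "x \<in> carrier C" for x
    using bij that by (auto simp: bij_betw_def)
  show "order_iso C D ?h"
    unfolding order_iso_def using bij
    by (simp add: h hc flip: C.lower_family_le_iff D.lower_family_le_iff)
  show "?h (e a) = d a" if "a \<in> carrier L" for a
    using that D.bij_betw_lower_family
    by (simp add: C.lower_family_e inv_into_f_f bij_betw_def flip: D.lower_family_e)
qed


section \<open>Powers\<close>

lemma mem_carrier_power:
  "xs \<in> carrier (power_lattice n L) \<longleftrightarrow> length xs = n \<and> (\<forall>k<n. xs ! k \<in> carrier L)"
  by (auto simp: power_lattice_def subset_eq all_set_conv_all_nth)

lemma power_le_iff:
  "xs \<sqsubseteq>\<^bsub>power_lattice n L\<^esub> ys \<longleftrightarrow>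
    length xs = length ys \<and> (\<forall>k<length xs. xs ! k \<sqsubseteq>\<^bsub>L\<^esub> ys ! k)"
  by (simp add: power_lattice_def list_all2_conv_all_nth)

lemma inv_gorder_power: "inv_gorder (power_lattice n L) = power_lattice n (inv_gorder L)"
proof -
  have "list_all2 (le L) ys xs = list_all2 (\<lambda>x y. le L y x) xs ys" for xs ys
    by (auto simp: list_all2_conv_all_nth)
  then show ?thesis by (simp add: power_lattice_def)
qed

lemma partial_order_power:
  assumes "partial_order C"
  shows "partial_order (power_lattice n C)"
proof -
  interpret C: partial_order C by (fact assms)
  let ?P = "power_lattice n C"
  have eq: "(.=\<^bsub>?P\<^esub>) = (=)" by (simp add: power_lattice_def)
  show ?thesis
  proof
    fix xs ys zs
    show "xs \<sqsubseteq>\<^bsub>?P\<^esub> xs" if "xs \<in> carrier ?P"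
      using that by (simp add: mem_carrier_power power_le_iff)
    show "xs .=\<^bsub>?P\<^esub> ys" if "xs \<sqsubseteq>\<^bsub>?P\<^esub> ys" "ys \<sqsubseteq>\<^bsub>?P\<^esub> xs" "xs \<in> carrier ?P" "ys \<in> carrier ?P"
      using that unfolding eq
      by (auto simp: mem_carrier_power power_le_iff intro!: nth_equalityI C.le_antisym)
    show "xs \<sqsubseteq>\<^bsub>?P\<^esub> zs" if "xs \<sqsubseteq>\<^bsub>?P\<^esub> ys" "ys \<sqsubseteq>\<^bsub>?P\<^esub> zs"
      "xs \<in> carrier ?P" "ys \<in> carrier ?P" "zs \<in> carrier ?P"
    proof -
      have "xs ! k \<sqsubseteq>\<^bsub>C\<^esub> zs ! k" if "k < n" for k
        using \<open>xs \<sqsubseteq>\<^bsub>?P\<^esub> ys\<close> \<open>ys \<sqsubseteq>\<^bsub>?P\<^esub> zs\<close> \<open>xs \<in> _\<close> \<open>ys \<in> _\<close> \<open>zs \<in> _\<close> that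
        by (intro C.le_trans[of "xs ! k" "ys ! k" "zs ! k"]) (simp_all add: mem_carrier_power power_le_iff)
      with that show ?thesis by (simp add: mem_carrier_power power_le_iff)
    qed
  qed (simp_all add: eq)
qed

lemma inf_power:
  assumes "complete_lattice C" and A: "A \<subseteq> carrier (power_lattice n C)"
  shows "\<Sqinter>\<^bsub>power_lattice n C\<^esub>A = map (\<lambda>k. \<Sqinter>\<^bsub>C\<^esub>((\<lambda>xs. xs ! k) ` A)) [0..<n]"
proof -
  interpret C: complete_lattice C by (fact assms)
  interpret P: partial_order "power_lattice n C"
    by (rule partial_order_power[OF C.partial_order_axioms])
  let ?m = "map (\<lambda>k. \<Sqinter>\<^bsub>C\<^esub>((\<lambda>xs. xs ! k) ` A)) [0..<n]"
  have A': "length xs = n" "k < n \<Longrightarrow> xs ! k \<in> carrier C" if "xs \<in> A" for xs k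
    using subsetD[OF A that] by (simp_all add: mem_carrier_power)
  have Ak: "(\<lambda>xs. xs ! k) ` A \<subseteq> carrier C" if "k < n" for k
    using A' that by blast
  show ?thesis
  proof (rule P.inf_eqI, rule greatest_LowerI)
    show "?m \<in> carrier (power_lattice n C)"
      using Ak by (simp add: mem_carrier_power)
    show "?m \<sqsubseteq>\<^bsub>power_lattice n C\<^esub> xs" if "xs \<in> A" for xs
      using A'(1)[OF that] C.inf_lower[OF Ak imageI[OF that]] by (simp add: power_le_iff)
    show "ys \<sqsubseteq>\<^bsub>power_lattice n C\<^esub> ?m" if "ys \<in> Lower (power_lattice n C) A" for ys
    proof -
      have ys: "length ys = n" "\<And>k. k < n \<Longrightarrow> ys ! k \<in> carrier C"
        using that by (simp_all add: Lower_def mem_carrier_power)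
      have ys_le: "ys ! k \<sqsubseteq>\<^bsub>C\<^esub> xs ! k" if "xs \<in> A" "k < n" for k xs
        using Lower_memD[OF \<open>ys \<in> Lower _ _\<close> that(1) A] that(2) ys(1) by (simp add: power_le_iff)
      have "ys ! k \<sqsubseteq>\<^bsub>C\<^esub> \<Sqinter>\<^bsub>C\<^esub>((\<lambda>xs. xs ! k) ` A)" if "k < n" for k
      proof (rule C.inf_greatest[OF Ak[OF that] ys(2)[OF that]])
        fix x assume "x \<in> (\<lambda>xs. xs ! k) ` A"
        then obtain xs where "xs \<in> A" "x = xs ! k" by (rule imageE)
        with ys_le[OF this(1) that] show "ys ! k \<sqsubseteq>\<^bsub>C\<^esub> x" by simp
      qed
      with ys(1) show ?thesis by (simp add: power_le_iff)
    qed
  qed (rule A)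
qed

text \<open>The hypotheses are kept at a complete \<open>C\<close>, a map into its carrier and a
  preimage of the top; in this form the lemma dualizes to open elements, with the bottom in place of
  the top.\<close>

lemma closed_elements_power:
  assumes "complete_lattice C" and e: "\<And>a. a \<in> carrier L \<Longrightarrow> e a \<in> carrier C"
    and t: "t \<in> carrier L" "e t = \<top>\<^bsub>C\<^esub>"
  shows "ps \<in> closed_elements (power_lattice n L) (power_lattice n C) (map e) \<longleftrightarrow>
    length ps = n \<and> (\<forall>k<n. ps ! k \<in> closed_elements L C e)"
proof
  interpret C: complete_lattice C by (fact assms)
  {
    assume "ps \<in> closed_elements (power_lattice n L) (power_lattice n C) (map e)"
    then obtain S where S: "S \<subseteq> carrier (power_lattice n L)" "ps = \<Sqinter>\<^bsub>power_lattice n C\<^esub>(map e ` S)"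
      by (auto simp: closed_elements_def)
    have S': "length as = n" "k < n \<Longrightarrow> as ! k \<in> carrier L" if "as \<in> S" for as k
      using subsetD[OF S(1) that] by (simp_all add: mem_carrier_power)
    then have "map e ` S \<subseteq> carrier (power_lattice n C)"
      using e by (auto simp: mem_carrier_power)
    from S(2)[unfolded inf_power[OF assms(1) this]]
    have ps: "ps = map (\<lambda>k. \<Sqinter>\<^bsub>C\<^esub>((\<lambda>xs. xs ! k) ` map e ` S)) [0..<n]" .
    have "(\<lambda>xs. xs ! k) ` map e ` S = e ` (\<lambda>as. as ! k) ` S" if "k < n" for k
      using S' that by (force simp: image_image)
    moreover have "(\<lambda>as. as ! k) ` S \<subseteq> carrier L" if "k < n" for k using S' that by auto
    ultimately show "length ps = n \<and> (\<forall>k<n. ps ! k \<in> closed_elements L C e)"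
      unfolding ps closed_elements_def by (simp, blast)
  }
  assume ps: "length ps = n \<and> (\<forall>k<n. ps ! k \<in> closed_elements L C e)"
  then have "\<forall>k\<in>{..<n}. \<exists>S. S \<subseteq> carrier L \<and> ps ! k = \<Sqinter>\<^bsub>C\<^esub>(e ` S)"
    by (simp add: closed_elements_def) blast
  then obtain S where S: "\<And>k. k < n \<Longrightarrow> S k \<subseteq> carrier L \<and> ps ! k = \<Sqinter>\<^bsub>C\<^esub>(e ` S k)"
    by (auto dest!: bchoice)
  \<comment> \<open>A product of generating sets projects onto its factors only if every factor is
    nonempty. Adding \<open>t\<close>, whose image is the top, ensures this and leaves each meet
    unchanged.\<close>
  let ?S = "{as. length as = n \<and> (\<forall>k<n. as ! k \<in> insert t (S k))}"
  have S_sub: "?S \<subseteq> carrier (power_lattice n L)"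
    using S t(1) by (fastforce simp: mem_carrier_power)
  then have mapS: "map e ` ?S \<subseteq> carrier (power_lattice n C)"
    using e by (auto simp: mem_carrier_power)
  have "(\<lambda>xs. xs ! k) ` map e ` ?S = e ` insert t (S k)" if k: "k < n" for k
  proof
    show "(\<lambda>xs. xs ! k) ` map e ` ?S \<subseteq> e ` insert t (S k)" using k by fastforce
    show "e ` insert t (S k) \<subseteq> (\<lambda>xs. xs ! k) ` map e ` ?S"
    proof
      fix y assume "y \<in> e ` insert t (S k)"
      then obtain a where a: "a \<in> insert t (S k)" "y = e a" by blast
      let ?as = "(replicate n t)[k := a]"
      have "?as \<in> ?S" using a(1) k by (auto simp: nth_list_update)
      moreover have "y = map e ?as ! k" using k a(2) by simp
      ultimately show "y \<in> (\<lambda>xs. xs ! k) ` map e ` ?S" by blast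
    qed
  qed
  moreover have "\<Sqinter>\<^bsub>C\<^esub>(e ` insert t (S k)) = ps ! k" if k: "k < n" for k
  proof -
    have eS: "e ` S k \<subseteq> carrier C" using S[OF k] e by auto
    have "e ` insert t (S k) \<subseteq> carrier C" using eS t e by simp
    then have "\<Sqinter>\<^bsub>C\<^esub>(e ` insert t (S k)) \<sqsubseteq>\<^bsub>C\<^esub> \<Sqinter>\<^bsub>C\<^esub>(e ` S k)" by (intro C.inf_mono) auto
    moreover have "\<Sqinter>\<^bsub>C\<^esub>(e ` S k) \<sqsubseteq>\<^bsub>C\<^esub> \<Sqinter>\<^bsub>C\<^esub>(e ` insert t (S k))"
    proof (rule C.inf_greatest)
      show "\<Sqinter>\<^bsub>C\<^esub>(e ` S k) \<sqsubseteq>\<^bsub>C\<^esub> x" if "x \<in> e ` insert t (S k)" for x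
      proof (cases "x \<in> e ` S k")
        case True
        then show ?thesis by (rule C.inf_lower[OF eS])
      next
        case False
        with that t(2) have "x = \<top>\<^bsub>C\<^esub>" by blast
        then show ?thesis using C.inf_closed[OF eS] by simp
      qed
    qed (use \<open>e ` insert t (S k) \<subseteq> carrier C\<close> C.inf_closed[OF eS] in simp_all)
    ultimately show ?thesis
      using S[OF k] C.le_antisym C.inf_closed[OF eS] C.inf_closed[OF \<open>e ` insert t (S k) \<subseteq> carrier C\<close>]
      by simp
  qed
  ultimately have "\<Sqinter>\<^bsub>power_lattice n C\<^esub>(map e ` ?S) = ps"
    using ps by (simp add: inf_power[OF assms(1) mapS] list_eq_iff_nth_eq del: insert_iff)
  with S_sub show "ps \<in> closed_elements (power_lattice n L) (power_lattice n C) (map e)"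
    unfolding closed_elements_def by blast
qed

lemma open_elements_power:
  assumes "complete_lattice C" "\<And>a. a \<in> carrier L \<Longrightarrow> e a \<in> carrier C"
    and "t \<in> carrier L" "e t = \<bottom>\<^bsub>C\<^esub>"
  shows "ps \<in> open_elements (power_lattice n L) (power_lattice n C) (map e) \<longleftrightarrow>
    length ps = n \<and> (\<forall>k<n. ps ! k \<in> open_elements L C e)"
  unfolding open_elements_dual inv_gorder_power
  by (rule closed_elements_power[OF complete_lattice.dual_complete_lattice[OF assms(1)]])
    (use assms in simp_all)


section \<open>Transfer of the extension of a map\<close>

text \<open>
  The conditions on \<open>g: C \<rightarrow> D\<close> over \<open>\<pi>: L \<rightarrow> M\<close> under which the intervals that enter the
  definition of \<open>f\<^sup>\<sigma>\<close> at \<open>x\<close> and at \<open>g x\<close> correspond.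
\<close>

locale interval_lifting =
  fixes L :: "('a, 'k) gorder_scheme" and C :: "('c, 'l) gorder_scheme" and e :: "'a \<Rightarrow> 'c"
    and M :: "('b, 'm) gorder_scheme" and D :: "('d, 'n) gorder_scheme" and d :: "'b \<Rightarrow> 'd"
    and \<pi> :: "'a \<Rightarrow> 'b" and g :: "'c \<Rightarrow> 'd"
  assumes e_closed: "a \<in> carrier L \<Longrightarrow> e a \<in> carrier C"
    and \<pi>_closed: "a \<in> carrier L \<Longrightarrow> \<pi> a \<in> carrier M"
    and g_closed: "x \<in> carrier C \<Longrightarrow> g x \<in> carrier D"
    and g_e: "a \<in> carrier L \<Longrightarrow> g (e a) = d (\<pi> a)"
    and g_closed_element: "p \<in> closed_elements L C e \<Longrightarrow> g p \<in> closed_elements M D d"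
    and g_open_element: "q \<in> open_elements L C e \<Longrightarrow> g q \<in> open_elements M D d"
    and closed_mono: "\<lbrakk>p \<in> closed_elements L C e; x \<in> carrier C; p \<sqsubseteq>\<^bsub>C\<^esub> x\<rbrakk> \<Longrightarrow> g p \<sqsubseteq>\<^bsub>D\<^esub> g x"
    and open_mono: "\<lbrakk>q \<in> open_elements L C e; x \<in> carrier C; x \<sqsubseteq>\<^bsub>C\<^esub> q\<rbrakk> \<Longrightarrow> g x \<sqsubseteq>\<^bsub>D\<^esub> g q"
    and closed_lift: "\<lbrakk>x \<in> carrier C; p' \<in> closed_elements M D d; p' \<sqsubseteq>\<^bsub>D\<^esub> g x\<rbrakk> \<Longrightarrow>
      \<exists>p. p \<in> closed_elements L C e \<and> p \<sqsubseteq>\<^bsub>C\<^esub> x \<and> g p = p'"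
    and open_lift: "\<lbrakk>x \<in> carrier C; q' \<in> open_elements M D d; g x \<sqsubseteq>\<^bsub>D\<^esub> q'\<rbrakk> \<Longrightarrow>
      \<exists>q. q \<in> open_elements L C e \<and> x \<sqsubseteq>\<^bsub>C\<^esub> q \<and> g q = q'"
    and interpolation: "\<lbrakk>x \<in> carrier C; p \<in> closed_elements L C e; q \<in> open_elements L C e;
      p \<sqsubseteq>\<^bsub>C\<^esub> x; x \<sqsubseteq>\<^bsub>C\<^esub> q; b \<in> carrier M; g p \<sqsubseteq>\<^bsub>D\<^esub> d b; d b \<sqsubseteq>\<^bsub>D\<^esub> g q\<rbrakk> \<Longrightarrow>
      \<exists>a. a \<in> carrier L \<and> \<pi> a = b \<and> p \<sqsubseteq>\<^bsub>C\<^esub> e a \<and> e a \<sqsubseteq>\<^bsub>C\<^esub> q"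

text \<open>Order, carrier, closed and open elements of a power are all coordinatewise, so universal
  conditions carry over at once, and witnesses for the existential ones are collected into a list by
  \<open>Skolem_list_nth\<close>.\<close>

lemma interval_lifting_power:
  assumes "interval_lifting L C e M D d \<pi> g"
    and C: "dense_compact_completion L C e" and D: "dense_compact_completion M D d"
  shows "interval_lifting (power_lattice n L) (power_lattice n C) (map e)
    (power_lattice n M) (power_lattice n D) (map d) (map \<pi>) (map g)"
proof -
  interpret interval_lifting L C e M D d \<pi> g by (fact assms)
  interpret C: dense_compact_completion L C e by (fact C)
  interpret D: dense_compact_completion M D d by (fact D)
  note closed_C = closed_elements_power[where L = L and C = C and e = e and n = n,
      OF C.C.complete_lattice_axioms e_closed C.L.top_closed C.e_top]
  note closed_D = closed_elements_power[where L = M and C = D and e = d and n = n,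
      OF D.C.complete_lattice_axioms D.e_closed D.L.top_closed D.e_top]
  note open_C = open_elements_power[where L = L and C = C and e = e and n = n,
      OF C.C.complete_lattice_axioms e_closed C.L.bottom_closed C.e_bottom]
  note open_D = open_elements_power[where L = M and C = D and e = d and n = n,
      OF D.C.complete_lattice_axioms D.e_closed D.L.bottom_closed D.e_bottom]
  note simps = closed_C closed_D open_C open_D mem_carrier_power power_le_iff
  show ?thesis
  proof
    fix as assume "as \<in> carrier (power_lattice n L)"
    then show "map e as \<in> carrier (power_lattice n C)" "map \<pi> as \<in> carrier (power_lattice n M)"
      "map g (map e as) = map d (map \<pi> as)"
      by (simp_all add: simps e_closed \<pi>_closed g_e list_eq_iff_nth_eq)
  next
    fix xs assume "xs \<in> carrier (power_lattice n C)"
    then show "map g xs \<in> carrier (power_lattice n D)" by (simp add: simps g_closed)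
  next
    fix ps assume "ps \<in> closed_elements (power_lattice n L) (power_lattice n C) (map e)"
    then show "map g ps \<in> closed_elements (power_lattice n M) (power_lattice n D) (map d)"
      by (simp add: simps g_closed_element)
  next
    fix qs assume "qs \<in> open_elements (power_lattice n L) (power_lattice n C) (map e)"
    then show "map g qs \<in> open_elements (power_lattice n M) (power_lattice n D) (map d)"
      by (simp add: simps g_open_element)
  next
    fix ps xs assume "ps \<in> closed_elements (power_lattice n L) (power_lattice n C) (map e)"
      "xs \<in> carrier (power_lattice n C)" "ps \<sqsubseteq>\<^bsub>power_lattice n C\<^esub> xs"
    then show "map g ps \<sqsubseteq>\<^bsub>power_lattice n D\<^esub> map g xs" by (simp add: simps closed_mono)
  next
    fix qs xs assume "qs \<in> open_elements (power_lattice n L) (power_lattice n C) (map e)"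
      "xs \<in> carrier (power_lattice n C)" "xs \<sqsubseteq>\<^bsub>power_lattice n C\<^esub> qs"
    then show "map g xs \<sqsubseteq>\<^bsub>power_lattice n D\<^esub> map g qs" by (simp add: simps open_mono)
  next
    fix xs ps' assume *: "xs \<in> carrier (power_lattice n C)"
      "ps' \<in> closed_elements (power_lattice n M) (power_lattice n D) (map d)"
      "ps' \<sqsubseteq>\<^bsub>power_lattice n D\<^esub> map g xs"
    then have "\<forall>k<n. \<exists>p. p \<in> closed_elements L C e \<and> p \<sqsubseteq>\<^bsub>C\<^esub> xs ! k \<and> g p = ps' ! k"
      by (intro allI impI closed_lift) (simp_all add: simps)
    then obtain ps where "length ps = n" "\<forall>k<n. ps ! k \<in> closed_elements L C e \<and>
        ps ! k \<sqsubseteq>\<^bsub>C\<^esub> xs ! k \<and> g (ps ! k) = ps' ! k"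
      unfolding Skolem_list_nth by blast
    then show "\<exists>ps. ps \<in> closed_elements (power_lattice n L) (power_lattice n C) (map e) \<and>
        ps \<sqsubseteq>\<^bsub>power_lattice n C\<^esub> xs \<and> map g ps = ps'"
      using * by (intro exI[of _ ps]) (simp add: simps list_eq_iff_nth_eq)
  next
    fix xs qs' assume *: "xs \<in> carrier (power_lattice n C)"
      "qs' \<in> open_elements (power_lattice n M) (power_lattice n D) (map d)"
      "map g xs \<sqsubseteq>\<^bsub>power_lattice n D\<^esub> qs'"
    then have "\<forall>k<n. \<exists>q. q \<in> open_elements L C e \<and> xs ! k \<sqsubseteq>\<^bsub>C\<^esub> q \<and> g q = qs' ! k"
      by (intro allI impI open_lift) (simp_all add: simps)
    then obtain qs where "length qs = n" "\<forall>k<n. qs ! k \<in> open_elements L C e \<and>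
        xs ! k \<sqsubseteq>\<^bsub>C\<^esub> qs ! k \<and> g (qs ! k) = qs' ! k"
      unfolding Skolem_list_nth by blast
    then show "\<exists>qs. qs \<in> open_elements (power_lattice n L) (power_lattice n C) (map e) \<and>
        xs \<sqsubseteq>\<^bsub>power_lattice n C\<^esub> qs \<and> map g qs = qs'"
      using * by (intro exI[of _ qs]) (simp add: simps list_eq_iff_nth_eq)
  next
    fix xs ps qs bs assume *: "xs \<in> carrier (power_lattice n C)"
      "ps \<in> closed_elements (power_lattice n L) (power_lattice n C) (map e)"
      "qs \<in> open_elements (power_lattice n L) (power_lattice n C) (map e)"
      "ps \<sqsubseteq>\<^bsub>power_lattice n C\<^esub> xs" "xs \<sqsubseteq>\<^bsub>power_lattice n C\<^esub> qs"
      "bs \<in> carrier (power_lattice n M)"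
      "map g ps \<sqsubseteq>\<^bsub>power_lattice n D\<^esub> map d bs" "map d bs \<sqsubseteq>\<^bsub>power_lattice n D\<^esub> map g qs"
    have "\<exists>a. a \<in> carrier L \<and> \<pi> a = bs ! k \<and> ps ! k \<sqsubseteq>\<^bsub>C\<^esub> e a \<and> e a \<sqsubseteq>\<^bsub>C\<^esub> qs ! k" if "k < n" for k
      using * that by (intro interpolation[of "xs ! k"]) (simp_all add: simps)
    then obtain as where "length as = n" "\<forall>k<n. as ! k \<in> carrier L \<and> \<pi> (as ! k) = bs ! k \<and>
        ps ! k \<sqsubseteq>\<^bsub>C\<^esub> e (as ! k) \<and> e (as ! k) \<sqsubseteq>\<^bsub>C\<^esub> qs ! k"
      using Skolem_list_nth[of n "\<lambda>k a. a \<in> carrier L \<and> \<pi> a = bs ! k \<and> ps ! k \<sqsubseteq>\<^bsub>C\<^esub> e a \<and> e a \<sqsubseteq>\<^bsub>C\<^esub> qs ! k"]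
      by blast
    then show "\<exists>as. as \<in> carrier (power_lattice n L) \<and> map \<pi> as = bs \<and>
        ps \<sqsubseteq>\<^bsub>power_lattice n C\<^esub> map e as \<and> map e as \<sqsubseteq>\<^bsub>power_lattice n C\<^esub> qs"
      using * by (intro exI[of _ as]) (simp add: simps list_eq_iff_nth_eq)
  qed
qed

text \<open>Monotonicity sends the interval between \<open>p\<close> and \<open>q\<close> into the
  one between \<open>g p\<close> and \<open>g q\<close>, and interpolation makes this onto, so the
  inner meets correspond. The two lifting conditions ensure that every pair around
  \<open>g x\<close> arises from a pair around \<open>x\<close>, so the outer joins correspond. As
  \<open>f\<close> need not be monotone, a comparison of endpoints would not give the equality of
  the sets of values.\<close>

lemma (in interval_lifting) sigma_extension_transfer:
  fixes K :: "('r, 's) gorder_scheme" and i :: "'t \<Rightarrow> 'r"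
    and N :: "('u, 'v) gorder_scheme" and j :: "'w \<Rightarrow> 'u"
  assumes x: "x \<in> carrier C"
    and "complete_lattice K"
    and h_sup: "\<And>A. A \<subseteq> carrier K \<Longrightarrow> h (\<Squnion>\<^bsub>K\<^esub>A) = \<Squnion>\<^bsub>N\<^esub>(h ` A)"
    and h_inf: "\<And>A. A \<subseteq> carrier K \<Longrightarrow> h (\<Sqinter>\<^bsub>K\<^esub>A) = \<Sqinter>\<^bsub>N\<^esub>(h ` A)"
    and if_closed: "\<And>a. a \<in> carrier L \<Longrightarrow> i (f a) \<in> carrier K"
    and h_i: "\<And>a. a \<in> carrier L \<Longrightarrow> h (i (f a)) = j (f' (\<pi> a))"
  shows "h (sigma_extension L C e K i f x) = sigma_extension M D d N j f' (g x)"
proof -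
  interpret K: complete_lattice K by (fact assms)
  let ?T = "\<lambda>p q. {i (f a) | a. a \<in> carrier L \<and> p \<sqsubseteq>\<^bsub>C\<^esub> e a \<and> e a \<sqsubseteq>\<^bsub>C\<^esub> q}"
  let ?T' = "\<lambda>p q. {j (f' b) | b. b \<in> carrier M \<and> p \<sqsubseteq>\<^bsub>D\<^esub> d b \<and> d b \<sqsubseteq>\<^bsub>D\<^esub> q}"
  let ?R = "\<lambda>p q. p \<in> closed_elements L C e \<and> q \<in> open_elements L C e \<and> p \<sqsubseteq>\<^bsub>C\<^esub> x \<and> x \<sqsubseteq>\<^bsub>C\<^esub> q"
  let ?R' = "\<lambda>p q. p \<in> closed_elements M D d \<and> q \<in> open_elements M D d \<and>
    p \<sqsubseteq>\<^bsub>D\<^esub> g x \<and> g x \<sqsubseteq>\<^bsub>D\<^esub> q"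
  have T: "?T p q \<subseteq> carrier K" for p q using if_closed by blast
  have "h ` ?T p q = ?T' (g p) (g q)" if "?R p q" for p q
  proof (intro equalityI subsetI)
    fix y assume "y \<in> h ` ?T p q"
    then obtain a where a: "a \<in> carrier L" "p \<sqsubseteq>\<^bsub>C\<^esub> e a" "e a \<sqsubseteq>\<^bsub>C\<^esub> q" "y = h (i (f a))" by blast
    with that closed_mono[of p "e a"] open_mono[of q "e a"]
    show "y \<in> ?T' (g p) (g q)" by (auto simp: h_i g_e \<pi>_closed e_closed)
  next
    fix y assume "y \<in> ?T' (g p) (g q)"
    then obtain b where b: "b \<in> carrier M" "g p \<sqsubseteq>\<^bsub>D\<^esub> d b" "d b \<sqsubseteq>\<^bsub>D\<^esub> g q" "y = j (f' b)" by blast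
    with that x interpolation[of x p q b] obtain a where
      "a \<in> carrier L" "\<pi> a = b" "p \<sqsubseteq>\<^bsub>C\<^esub> e a" "e a \<sqsubseteq>\<^bsub>C\<^esub> q" by blast
    moreover from this(1,2) have "y = h (i (f a))" by (simp add: b(4) h_i)
    ultimately show "y \<in> h ` ?T p q" by blast
  qed
  then have h_T: "h (\<Sqinter>\<^bsub>K\<^esub>(?T p q)) = \<Sqinter>\<^bsub>N\<^esub>(?T' (g p) (g q))" if "?R p q" for p q
    using that h_inf[OF T] by simp
  have R: "?R' (g p) (g q)" if "?R p q" for p q
    using that x by (simp add: g_closed_element g_open_element closed_mono open_mono)
  have R': "\<exists>p q. ?R p q \<and> g p = p' \<and> g q = q'" if "?R' p' q'" for p' q'
    using that closed_lift[OF x, of p'] open_lift[OF x, of q'] by blast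
  have "h ` {\<Sqinter>\<^bsub>K\<^esub>(?T p q) | p q. ?R p q} = {\<Sqinter>\<^bsub>N\<^esub>(?T' p q) | p q. ?R' p q}"
  proof (intro equalityI subsetI)
    fix y assume "y \<in> h ` {\<Sqinter>\<^bsub>K\<^esub>(?T p q) | p q. ?R p q}"
    then obtain p q where pq: "?R p q" "y = h (\<Sqinter>\<^bsub>K\<^esub>(?T p q))" by blast
    with R[OF pq(1)] h_T[OF pq(1)] show "y \<in> {\<Sqinter>\<^bsub>N\<^esub>(?T' p q) | p q. ?R' p q}" by blast
  next
    fix y assume "y \<in> {\<Sqinter>\<^bsub>N\<^esub>(?T' p q) | p q. ?R' p q}"
    then obtain p' q' where "?R' p' q'" and y: "y = \<Sqinter>\<^bsub>N\<^esub>(?T' p' q')" by blast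
    from R'[OF this(1)] obtain p q where pq: "?R p q" "g p = p'" "g q = q'" by blast
    from h_T[OF pq(1)] have "y = h (\<Sqinter>\<^bsub>K\<^esub>(?T p q))" unfolding y pq(2,3) by (rule sym)
    with pq(1) show "y \<in> h ` {\<Sqinter>\<^bsub>K\<^esub>(?T p q) | p q. ?R p q}" by blast
  qed
  moreover have "{\<Sqinter>\<^bsub>K\<^esub>(?T p q) | p q. ?R p q} \<subseteq> carrier K"
    using K.inf_closed[OF T] by blast
  ultimately show ?thesis unfolding sigma_extension_def using h_sup by simp
qed

text \<open>Allows the conditions to be verified on one concrete completion, here the product over
  the ultrafilters, and then moved to an arbitrary canonical extension of the same lattice.\<close>

lemma interval_lifting_order_iso:
  assumes "interval_lifting L K j M D d \<pi> g"
    and C: "dense_compact_completion L C e" and K: "dense_compact_completion L K j"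
    and h: "order_iso C K h" and h_e: "\<And>a. a \<in> carrier L \<Longrightarrow> h (e a) = j a"
  shows "interval_lifting L C e M D d \<pi> (\<lambda>x. g (h x))"
proof -
  interpret interval_lifting L K j M D d \<pi> g by (fact assms)
  interpret C: dense_compact_completion L C e by (fact C)
  interpret K: dense_compact_completion L K j by (fact K)
  have h_closed: "h x \<in> carrier K" if "x \<in> carrier C" for x
    using h that by (auto simp: order_iso_def bij_betw_def)
  have h_le: "h x \<sqsubseteq>\<^bsub>K\<^esub> h y \<longleftrightarrow> x \<sqsubseteq>\<^bsub>C\<^esub> y" if "x \<in> carrier C" "y \<in> carrier C" for x y
    using h that by (simp add: order_iso_def)
  have h_image: "h ` e ` S = j ` S" if "S \<subseteq> carrier L" for S
    unfolding image_image using that h_e by (intro image_cong) auto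
  have h_inf: "h (\<Sqinter>\<^bsub>C\<^esub>(e ` S)) = \<Sqinter>\<^bsub>K\<^esub>(j ` S)" if "S \<subseteq> carrier L" for S
    using order_iso_inf[OF C.C.complete_lattice_axioms K.C.complete_lattice_axioms h
        C.image_e_closed[OF that]] by (simp add: h_image[OF that])
  have h_sup: "h (\<Squnion>\<^bsub>C\<^esub>(e ` S)) = \<Squnion>\<^bsub>K\<^esub>(j ` S)" if "S \<subseteq> carrier L" for S
    using order_iso_sup[OF C.C.complete_lattice_axioms K.C.complete_lattice_axioms h
        C.image_e_closed[OF that]] by (simp add: h_image[OF that])
  have closed: "h p \<in> closed_elements L K j" if "p \<in> closed_elements L C e" for p
    using that h_inf unfolding closed_elements_def by blast
  have opn: "h q \<in> open_elements L K j" if "q \<in> open_elements L C e" for q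
    using that h_sup unfolding open_elements_def by blast
  have closed': "\<exists>p. p \<in> closed_elements L C e \<and> h p = p'" if "p' \<in> closed_elements L K j" for p'
    using that h_inf unfolding closed_elements_def by blast
  have opn': "\<exists>q. q \<in> open_elements L C e \<and> h q = q'" if "q' \<in> open_elements L K j" for q'
    using that h_sup unfolding open_elements_def by blast
  note [simp] = C.closed_element_in_carrier C.open_element_in_carrier h_closed h_le closed opn
  show ?thesis
  proof
    show "e a \<in> carrier C" "\<pi> a \<in> carrier M" "g (h (e a)) = d (\<pi> a)" if "a \<in> carrier L" for a
      using that by (simp_all add: \<pi>_closed h_e g_e)
    show "g (h x) \<in> carrier D" if "x \<in> carrier C" for x
      using that by (simp add: g_closed)
    show "g (h p) \<in> closed_elements M D d" if "p \<in> closed_elements L C e" for p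
      using that by (simp add: g_closed_element)
    show "g (h q) \<in> open_elements M D d" if "q \<in> open_elements L C e" for q
      using that by (simp add: g_open_element)
    show "g (h p) \<sqsubseteq>\<^bsub>D\<^esub> g (h x)" if "p \<in> closed_elements L C e" "x \<in> carrier C" "p \<sqsubseteq>\<^bsub>C\<^esub> x" for p x
      using that by (simp add: closed_mono)
    show "g (h x) \<sqsubseteq>\<^bsub>D\<^esub> g (h q)" if "q \<in> open_elements L C e" "x \<in> carrier C" "x \<sqsubseteq>\<^bsub>C\<^esub> q" for q x
      using that by (simp add: open_mono)
    show "\<exists>p. p \<in> closed_elements L C e \<and> p \<sqsubseteq>\<^bsub>C\<^esub> x \<and> g (h p) = p'"
      if "x \<in> carrier C" "p' \<in> closed_elements M D d" "p' \<sqsubseteq>\<^bsub>D\<^esub> g (h x)" for x p'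
    proof -
      from closed_lift[OF h_closed[OF that(1)] that(2,3)] obtain k where
        k: "k \<in> closed_elements L K j" "k \<sqsubseteq>\<^bsub>K\<^esub> h x" "g k = p'" by blast
      with closed' obtain p where "p \<in> closed_elements L C e" "h p = k" by blast
      with k that(1) show ?thesis by (intro exI[of _ p]) (simp flip: h_le)
    qed
    show "\<exists>q. q \<in> open_elements L C e \<and> x \<sqsubseteq>\<^bsub>C\<^esub> q \<and> g (h q) = q'"
      if "x \<in> carrier C" "q' \<in> open_elements M D d" "g (h x) \<sqsubseteq>\<^bsub>D\<^esub> q'" for x q'
    proof -
      from open_lift[OF h_closed[OF that(1)] that(2,3)] obtain k where
        k: "k \<in> open_elements L K j" "h x \<sqsubseteq>\<^bsub>K\<^esub> k" "g k = q'" by blast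
      with opn' obtain q where "q \<in> open_elements L C e" "h q = k" by blast
      with k that(1) show ?thesis by (intro exI[of _ q]) (simp flip: h_le)
    qed
    show "\<exists>a. a \<in> carrier L \<and> \<pi> a = b \<and> p \<sqsubseteq>\<^bsub>C\<^esub> e a \<and> e a \<sqsubseteq>\<^bsub>C\<^esub> q"
      if "x \<in> carrier C" "p \<in> closed_elements L C e" "q \<in> open_elements L C e"
        "p \<sqsubseteq>\<^bsub>C\<^esub> x" "x \<sqsubseteq>\<^bsub>C\<^esub> q" "b \<in> carrier M" "g (h p) \<sqsubseteq>\<^bsub>D\<^esub> d b" "d b \<sqsubseteq>\<^bsub>D\<^esub> g (h q)" for x p q b
    proof -
      have "\<exists>a. a \<in> carrier L \<and> \<pi> a = b \<and> h p \<sqsubseteq>\<^bsub>K\<^esub> j a \<and> j a \<sqsubseteq>\<^bsub>K\<^esub> h q"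
        using that by (intro interpolation[of "h x"]) simp_all
      then obtain a where a: "a \<in> carrier L" "\<pi> a = b" "h p \<sqsubseteq>\<^bsub>K\<^esub> j a" "j a \<sqsubseteq>\<^bsub>K\<^esub> h q" by blast
      with that h_e[OF a(1)] h_le[of p "e a"] h_le[of "e a" q] show ?thesis by auto
    qed
  qed
qed


section \<open>Products\<close>

lemma mem_carrier_product: "x \<in> carrier (product_algebra I L) \<longleftrightarrow> x \<in> (\<Pi>\<^sub>E i\<in>I. carrier (L i))"
  by (simp add: product_algebra_def)

lemma product_component:
  "\<lbrakk>x \<in> carrier (product_algebra I L); i \<in> I\<rbrakk> \<Longrightarrow> x i \<in> carrier (L i)"
  unfolding mem_carrier_product by (rule PiE_mem)

lemma product_component_image:
  "\<lbrakk>A \<subseteq> carrier (product_algebra I L); i \<in> I\<rbrakk> \<Longrightarrow> (\<lambda>x. x i) ` A \<subseteq> carrier (L i)"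
  by (rule image_subsetI) (rule product_component[OF subsetD])

lemma product_le_iff: "x \<sqsubseteq>\<^bsub>product_algebra I L\<^esub> y \<longleftrightarrow> (\<forall>i\<in>I. x i \<sqsubseteq>\<^bsub>L i\<^esub> y i)"
  by (simp add: product_algebra_def)

lemma product_eqI:
  "\<lbrakk>x \<in> carrier (product_algebra I L); y \<in> carrier (product_algebra I L); \<And>i. i \<in> I \<Longrightarrow> x i = y i\<rbrakk>
    \<Longrightarrow> x = y"
  unfolding mem_carrier_product by (rule PiE_ext)

lemma product_oper:
  "oper (product_algebra I L) f xs = (\<lambda>i\<in>I. oper (L i) f (map (\<lambda>x. x i) xs))"
  by (simp add: product_algebra_def)

lemma partial_order_product:
  assumes "\<And>i. i \<in> I \<Longrightarrow> partial_order (L i)"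
  shows "partial_order (product_algebra I L)"
proof -
  let ?P = "product_algebra I L"
  have eq: "(.=\<^bsub>?P\<^esub>) = (=)" by (simp add: product_algebra_def)
  have weak: "weak_partial_order (L i)" if "i \<in> I" for i
    using assms[OF that] by (rule partial_order.axioms)
  show ?thesis
  proof
    fix x y z
    show "x \<sqsubseteq>\<^bsub>?P\<^esub> x" if "x \<in> carrier ?P"
      unfolding product_le_iff using weak_partial_order.le_refl[OF weak] product_component[OF that]
      by blast
    show "x .=\<^bsub>?P\<^esub> y" if "x \<sqsubseteq>\<^bsub>?P\<^esub> y" "y \<sqsubseteq>\<^bsub>?P\<^esub> x" "x \<in> carrier ?P" "y \<in> carrier ?P"
      unfolding eq
    proof (rule product_eqI[OF that(3,4)])
      fix i assume i: "i \<in> I"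
      with that(1,2) show "x i = y i"
        unfolding product_le_iff
        by (intro partial_order.le_antisym[OF assms[OF i]] product_component[OF that(3)]
            product_component[OF that(4)]) simp_all
    qed
    show "x \<sqsubseteq>\<^bsub>?P\<^esub> z" if "x \<sqsubseteq>\<^bsub>?P\<^esub> y" "y \<sqsubseteq>\<^bsub>?P\<^esub> z"
      "x \<in> carrier ?P" "y \<in> carrier ?P" "z \<in> carrier ?P"
      unfolding product_le_iff
    proof
      fix i assume i: "i \<in> I"
      then show "x i \<sqsubseteq>\<^bsub>L i\<^esub> z i"
        using that(1,2) product_component[OF that(3) i] product_component[OF that(4) i]
          product_component[OF that(5) i] unfolding product_le_iff
        by (intro weak_partial_order.le_trans[OF weak[OF i], of "x i" "y i" "z i"]) simp_all
    qed
  qed (simp_all add: eq)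
qed

text \<open>Asks for a least upper bound of this one set in each coordinate, so that it serves
  arbitrary joins in complete factors and binary joins in the \<open>L i\<close> alike.\<close>

lemma least_product:
  assumes A: "A \<subseteq> carrier (product_algebra I L)"
    and s: "s \<in> extensional I" "\<And>i. i \<in> I \<Longrightarrow> is_lub (L i) (s i) ((\<lambda>x. x i) ` A)"
  shows "is_lub (product_algebra I L) s A"
proof (rule least_UpperI)
  show "s \<in> carrier (product_algebra I L)"
    using s(1) least_closed[OF s(2)] unfolding mem_carrier_product PiE_def by blast
  show "x \<sqsubseteq>\<^bsub>product_algebra I L\<^esub> s" if "x \<in> A" for x
    unfolding product_le_iff
    using least_Upper_above[OF s(2) imageI[OF that] product_component_image[OF A]] by blast
  show "s \<sqsubseteq>\<^bsub>product_algebra I L\<^esub> y" if y: "y \<in> Upper (product_algebra I L) A" for y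
    unfolding product_le_iff
  proof
    fix i assume i: "i \<in> I"
    have yc: "y \<in> carrier (product_algebra I L)" using y by (simp add: Upper_def)
    have "y i \<in> Upper (L i) ((\<lambda>x. x i) ` A)"
    proof (rule Upper_memI[OF _ product_component[OF yc i]])
      fix z assume "z \<in> (\<lambda>x. x i) ` A"
      then obtain x where "x \<in> A" "z = x i" by (rule imageE)
      with Upper_memD[OF y this(1) A] i show "z \<sqsubseteq>\<^bsub>L i\<^esub> y i" by (simp add: product_le_iff)
    qed
    then show "s i \<sqsubseteq>\<^bsub>L i\<^esub> y i" by (rule least_le[OF s(2)[OF i]])
  qed
qed (rule A)

lemma greatest_product:
  assumes A: "A \<subseteq> carrier (product_algebra I L)"
    and s: "s \<in> extensional I" "\<And>i. i \<in> I \<Longrightarrow> is_glb (L i) (s i) ((\<lambda>x. x i) ` A)"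
  shows "is_glb (product_algebra I L) s A"
proof (rule greatest_LowerI)
  show "s \<in> carrier (product_algebra I L)"
    using s(1) greatest_closed[OF s(2)] unfolding mem_carrier_product PiE_def by blast
  show "s \<sqsubseteq>\<^bsub>product_algebra I L\<^esub> x" if "x \<in> A" for x
    unfolding product_le_iff
    using greatest_Lower_below[OF s(2) imageI[OF that] product_component_image[OF A]] by blast
  show "y \<sqsubseteq>\<^bsub>product_algebra I L\<^esub> s" if y: "y \<in> Lower (product_algebra I L) A" for y
    unfolding product_le_iff
  proof
    fix i assume i: "i \<in> I"
    have yc: "y \<in> carrier (product_algebra I L)" using y by (simp add: Lower_def)
    have "y i \<in> Lower (L i) ((\<lambda>x. x i) ` A)"
    proof (rule Lower_memI[OF _ product_component[OF yc i]])
      fix z assume "z \<in> (\<lambda>x. x i) ` A"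
      then obtain x where "x \<in> A" "z = x i" by (rule imageE)
      with Lower_memD[OF y this(1) A] i show "y i \<sqsubseteq>\<^bsub>L i\<^esub> z" by (simp add: product_le_iff)
    qed
    then show "y i \<sqsubseteq>\<^bsub>L i\<^esub> s i" by (rule greatest_le[OF s(2)[OF i]])
  qed
qed (rule A)

lemma lub_product:
  assumes "\<And>i. i \<in> I \<Longrightarrow> complete_lattice (L i)" and A: "A \<subseteq> carrier (product_algebra I L)"
  shows "is_lub (product_algebra I L) (\<lambda>i\<in>I. \<Squnion>\<^bsub>L i\<^esub>((\<lambda>x. x i) ` A)) A"
proof (rule least_product[OF A])
  fix i assume i: "i \<in> I"
  interpret complete_lattice "L i" by (rule assms(1)[OF i])
  show "is_lub (L i) ((\<lambda>i\<in>I. \<Squnion>\<^bsub>L i\<^esub>((\<lambda>x. x i) ` A)) i) ((\<lambda>x. x i) ` A)"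
    using i sup_lub[OF product_component_image[OF A i]] by simp
qed simp

lemma glb_product:
  assumes "\<And>i. i \<in> I \<Longrightarrow> complete_lattice (L i)" and A: "A \<subseteq> carrier (product_algebra I L)"
  shows "is_glb (product_algebra I L) (\<lambda>i\<in>I. \<Sqinter>\<^bsub>L i\<^esub>((\<lambda>x. x i) ` A)) A"
proof (rule greatest_product[OF A])
  fix i assume i: "i \<in> I"
  interpret complete_lattice "L i" by (rule assms(1)[OF i])
  show "is_glb (L i) ((\<lambda>i\<in>I. \<Sqinter>\<^bsub>L i\<^esub>((\<lambda>x. x i) ` A)) i) ((\<lambda>x. x i) ` A)"
    using i inf_glb[OF product_component_image[OF A i]] by simp
qed simp

lemma complete_lattice_product:
  assumes "\<And>i. i \<in> I \<Longrightarrow> complete_lattice (L i)"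
  shows "complete_lattice (product_algebra I L)"
proof -
  interpret partial_order "product_algebra I L"
    using assms by (intro partial_order_product complete_lattice.axioms)
  show ?thesis
  proof
    fix A assume A: "A \<subseteq> carrier (product_algebra I L)"
    show "\<exists>s. is_lub (product_algebra I L) s A" by (rule exI, rule lub_product[OF assms A])
    show "\<exists>s. is_glb (product_algebra I L) s A" by (rule exI, rule glb_product[OF assms A])
  qed
qed

lemma product_sup_component:
  assumes "\<And>i. i \<in> I \<Longrightarrow> complete_lattice (L i)" "A \<subseteq> carrier (product_algebra I L)" "i \<in> I"
  shows "(\<Squnion>\<^bsub>product_algebra I L\<^esub>A) i = \<Squnion>\<^bsub>L i\<^esub>((\<lambda>x. x i) ` A)"
  using partial_order.sup_eqI[OF complete_lattice.axioms(1)[OF complete_lattice_product[OF assms(1)]]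
      lub_product[OF assms(1,2)]] assms(3) by simp

lemma product_inf_component:
  assumes "\<And>i. i \<in> I \<Longrightarrow> complete_lattice (L i)" "A \<subseteq> carrier (product_algebra I L)" "i \<in> I"
  shows "(\<Sqinter>\<^bsub>product_algebra I L\<^esub>A) i = \<Sqinter>\<^bsub>L i\<^esub>((\<lambda>x. x i) ` A)"
  using partial_order.inf_eqI[OF complete_lattice.axioms(1)[OF complete_lattice_product[OF assms(1)]]
      glb_product[OF assms(1,2)]] assms(3) by simp


section \<open>Ultraproducts\<close>

abbreviation ultraclass ::
  "'i set \<Rightarrow> ('i \<Rightarrow> ('a, 'f) lba) \<Rightarrow> 'i filter \<Rightarrow> ('i \<Rightarrow> 'a) \<Rightarrow> ('i \<Rightarrow> 'a) set" where
  "ultraclass I L U x \<equiv> ultraproduct_rel I L U `` {x}"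

lemma mem_ultraclass:
  assumes "U \<in> ultrafilters I" "x \<in> carrier (product_algebra I L)"
  shows "y \<in> ultraclass I L U x \<longleftrightarrow>
    y \<in> carrier (product_algebra I L) \<and> eventually (\<lambda>i. x i = y i) U"
proof -
  have "eventually (\<lambda>i. i \<in> {i\<in>I. x i = y i}) U \<longleftrightarrow> eventually (\<lambda>i. x i = y i) U"
    using ultrafilter_eventually_in[OF assms(1)] by (simp add: eventually_conj_iff)
  then show ?thesis using assms(2) by (simp add: ultraproduct_rel_def)
qed

lemma ultraclass_eqI:
  assumes "U \<in> ultrafilters I" "x \<in> carrier (product_algebra I L)" "y \<in> carrier (product_algebra I L)"
    and "eventually (\<lambda>i. x i = y i) U"
  shows "ultraclass I L U x = ultraclass I L U y"
proof -
  have "eventually (\<lambda>i. x i = z i) U \<longleftrightarrow> eventually (\<lambda>i. y i = z i) U" for z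
    by (rule eventually_cong[OF assms(4)]) simp
  then show ?thesis
    by (intro Set.set_eqI) (simp add: mem_ultraclass[OF assms(1,2)] mem_ultraclass[OF assms(1,3)] del: Image_singleton_iff)
qed

lemma carrier_ultraproduct:
  "carrier (ultraproduct I L U) = ultraclass I L U ` carrier (product_algebra I L)"
  by (auto simp: ultraproduct_def quotient_algebra_def quotient_def)

text \<open>That the product and the ultraproducts are bounded lattices comes with
  \<open>product\<close> and \<open>extension\<close>; it remains to identify their joins, meets and
  bounds with those computed from components and representatives.\<close>

locale ultraproduct_extensions =
  fixes I :: "'i set" and F :: "'f set" and ar :: "'f \<Rightarrow> nat" and L :: "'i \<Rightarrow> ('a, 'f) lba"
    and D :: "'i filter \<Rightarrow> ('d, 'f) lba" and d :: "'i filter \<Rightarrow> ('i \<Rightarrow> 'a) set \<Rightarrow> 'd"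
  assumes factor: "i \<in> I \<Longrightarrow> lattice_based_algebra F ar (L i)"
    and product: "lattice_based_algebra F ar (product_algebra I L)"
    and extension:
      "U \<in> ultrafilters I \<Longrightarrow> canonical_extension F ar (ultraproduct I L U) (D U) (d U)"
begin

section \<open>Order, lattice operations and added operations of the ultraproducts\<close>

abbreviation "P \<equiv> product_algebra I L"
abbreviation "Q \<equiv> ultraproduct I L"
abbreviation "cls \<equiv> ultraclass I L"
abbreviation "UF \<equiv> ultrafilters I"
abbreviation "E \<equiv> product_algebra (ultrafilters I) D"

definition j :: "('i \<Rightarrow> 'a) \<Rightarrow> 'i filter \<Rightarrow> 'd" where
  "j x = (\<lambda>U\<in>UF. d U (cls U x))"

sublocale P: bounded_lattice P
  using product by (rule lattice_based_algebra.axioms)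

lemma factor_lattice: "i \<in> I \<Longrightarrow> bounded_lattice (L i)"
  by (rule lattice_based_algebra.axioms[OF factor])

lemma ultraproduct_completion:
  "U \<in> UF \<Longrightarrow> dense_compact_completion (Q U) (D U) (d U)"
  by (rule canonical_extension.axioms[OF extension])

lemma complete_D: "U \<in> UF \<Longrightarrow> complete_lattice (D U)"
  by (rule dense_compact_completion.axioms[OF ultraproduct_completion])

lemma cls_closed: "x \<in> carrier P \<Longrightarrow> cls U x \<in> carrier (Q U)"
  by (simp add: carrier_ultraproduct del: Image_singleton_iff)

lemma join_component:
  assumes "x \<in> carrier P" "y \<in> carrier P" "i \<in> I"
  shows "(x \<squnion>\<^bsub>P\<^esub> y) i = x i \<squnion>\<^bsub>L i\<^esub> y i"
proof -
  have "is_lub P (\<lambda>i\<in>I. x i \<squnion>\<^bsub>L i\<^esub> y i) {x, y}"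
  proof (rule least_product)
    fix i assume i: "i \<in> I"
    interpret bounded_lattice "L i" by (rule factor_lattice[OF i])
    show "is_lub (L i) ((\<lambda>i\<in>I. x i \<squnion>\<^bsub>L i\<^esub> y i) i) ((\<lambda>x. x i) ` {x, y})"
      using i sup_of_two_least[of "x i" "y i"] assms(1,2)[THEN product_component]
      by (simp add: join_def)
  qed (use assms in simp_all)
  from P.sup_eqI[OF this] assms(3) show ?thesis by (simp add: join_def)
qed

lemma meet_component:
  assumes "x \<in> carrier P" "y \<in> carrier P" "i \<in> I"
  shows "(x \<sqinter>\<^bsub>P\<^esub> y) i = x i \<sqinter>\<^bsub>L i\<^esub> y i"
proof -
  have "is_glb P (\<lambda>i\<in>I. x i \<sqinter>\<^bsub>L i\<^esub> y i) {x, y}"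
  proof (rule greatest_product)
    fix i assume i: "i \<in> I"
    interpret bounded_lattice "L i" by (rule factor_lattice[OF i])
    show "is_glb (L i) ((\<lambda>i\<in>I. x i \<sqinter>\<^bsub>L i\<^esub> y i) i) ((\<lambda>x. x i) ` {x, y})"
      using i inf_of_two_greatest[of "x i" "y i"] assms(1,2)[THEN product_component]
      by (simp add: meet_def)
  qed (use assms in simp_all)
  from P.inf_eqI[OF this] assms(3) show ?thesis by (simp add: meet_def)
qed

text \<open>The theorem of Los for the order relation. Representatives \<open>z\<close>,
  \<open>w\<close> as in the definition of the quotient order agree with \<open>x\<close>,
  \<open>y\<close> on a member of \<open>U\<close>, and meets in \<open>P\<close> are
  coordinatewise.\<close>

lemma cls_le_iff:
  assumes U: "U \<in> UF" and x: "x \<in> carrier P" and y: "y \<in> carrier P"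
  shows "cls U x \<sqsubseteq>\<^bsub>Q U\<^esub> cls U y \<longleftrightarrow> eventually (\<lambda>i. x i \<sqsubseteq>\<^bsub>L i\<^esub> y i) U"
proof -
  have le: "x i \<sqsubseteq>\<^bsub>L i\<^esub> y i \<longleftrightarrow> x i = x i \<sqinter>\<^bsub>L i\<^esub> y i" if "i \<in> I" for i
  proof -
    interpret bounded_lattice "L i" by (rule factor_lattice[OF that])
    show ?thesis using product_component[OF x that] product_component[OF y that]
      by (rule le_iff_join)
  qed
  have "cls U x \<sqsubseteq>\<^bsub>Q U\<^esub> cls U y \<longleftrightarrow> (\<exists>z\<in>cls U x. \<exists>w\<in>cls U y. z \<sqinter>\<^bsub>P\<^esub> w \<in> cls U x)"
    by (simp add: ultraproduct_def quotient_algebra_def)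
  also have "\<dots> \<longleftrightarrow> eventually (\<lambda>i. x i = (x \<sqinter>\<^bsub>P\<^esub> y) i) U"
  proof
    assume "\<exists>z\<in>cls U x. \<exists>w\<in>cls U y. z \<sqinter>\<^bsub>P\<^esub> w \<in> cls U x"
    then obtain z w where "z \<in> cls U x" "w \<in> cls U y" "z \<sqinter>\<^bsub>P\<^esub> w \<in> cls U x" by blast
    then have zw: "z \<in> carrier P" "w \<in> carrier P" and ev: "eventually (\<lambda>i. x i = z i) U"
      "eventually (\<lambda>i. y i = w i) U" "eventually (\<lambda>i. x i = (z \<sqinter>\<^bsub>P\<^esub> w) i) U"
      by (simp_all add: mem_ultraclass[OF U x] mem_ultraclass[OF U y] del: Image_singleton_iff)
    from ev ultrafilter_eventually_in[OF U] show "eventually (\<lambda>i. x i = (x \<sqinter>\<^bsub>P\<^esub> y) i) U"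
      by eventually_elim (simp add: meet_component x y zw)
  next
    assume "eventually (\<lambda>i. x i = (x \<sqinter>\<^bsub>P\<^esub> y) i) U"
    then have "x \<sqinter>\<^bsub>P\<^esub> y \<in> cls U x" "x \<in> cls U x" "y \<in> cls U y"
      using x y by (simp_all add: mem_ultraclass[OF U x] mem_ultraclass[OF U y] del: Image_singleton_iff)
    then show "\<exists>z\<in>cls U x. \<exists>w\<in>cls U y. z \<sqinter>\<^bsub>P\<^esub> w \<in> cls U x" by blast
  qed
  also have "\<dots> \<longleftrightarrow> eventually (\<lambda>i. x i \<sqsubseteq>\<^bsub>L i\<^esub> y i) U"
    by (rule eventually_cong[OF ultrafilter_eventually_in[OF U]]) (simp add: le meet_component x y)
  finally show ?thesis .
qed

lemma cls_mono:
  assumes "U \<in> UF" "x \<in> carrier P" "y \<in> carrier P" "x \<sqsubseteq>\<^bsub>P\<^esub> y"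
  shows "cls U x \<sqsubseteq>\<^bsub>Q U\<^esub> cls U y"
  unfolding cls_le_iff[OF assms(1-3)]
  using ultrafilter_eventually_in[OF assms(1)] assms(4)
  by (auto simp: product_le_iff intro: eventually_mono)

text \<open>By \<open>cls_le_iff\<close> the universal property of a least upper bound is an almost
  everywhere statement, and it holds in each factor.\<close>

lemma cls_join:
  assumes U: "U \<in> UF" and x: "x \<in> carrier P" and y: "y \<in> carrier P"
  shows "cls U (x \<squnion>\<^bsub>P\<^esub> y) = cls U x \<squnion>\<^bsub>Q U\<^esub> cls U y"
proof -
  interpret Q: dense_compact_completion "Q U" "D U" "d U" by (rule ultraproduct_completion[OF U])
  have xy: "x \<squnion>\<^bsub>P\<^esub> y \<in> carrier P" using x y by simp
  have "is_lub (Q U) (cls U (x \<squnion>\<^bsub>P\<^esub> y)) {cls U x, cls U y}"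
  proof (rule least_UpperI)
    fix X assume "X \<in> {cls U x, cls U y}"
    then show "X \<sqsubseteq>\<^bsub>Q U\<^esub> cls U (x \<squnion>\<^bsub>P\<^esub> y)"
      using cls_mono[OF U x xy P.join_left[OF x y]] cls_mono[OF U y xy P.join_right[OF x y]] by blast
  next
    fix Z assume Z: "Z \<in> Upper (Q U) {cls U x, cls U y}"
    then have "Z \<in> carrier (Q U)" by (simp add: Upper_def)
    then obtain z where z: "z \<in> carrier P" "Z = cls U z" unfolding carrier_ultraproduct by blast
    have "cls U x \<sqsubseteq>\<^bsub>Q U\<^esub> cls U z" "cls U y \<sqsubseteq>\<^bsub>Q U\<^esub> cls U z"
      using Upper_memD[OF Z] cls_closed[OF x] cls_closed[OF y] unfolding z(2) by simp_all
    then have "eventually (\<lambda>i. x i \<sqsubseteq>\<^bsub>L i\<^esub> z i) U" "eventually (\<lambda>i. y i \<sqsubseteq>\<^bsub>L i\<^esub> z i) U"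
      using cls_le_iff[OF U] x y z(1) by blast+
    with ultrafilter_eventually_in[OF U] have "eventually (\<lambda>i. (x \<squnion>\<^bsub>P\<^esub> y) i \<sqsubseteq>\<^bsub>L i\<^esub> z i) U"
    proof eventually_elim
      case (elim i)
      interpret bounded_lattice "L i" by (rule factor_lattice[OF elim(1)])
      show ?case
        using join_le[OF elim(2,3)] elim(1) x y z(1)
        by (simp add: join_component product_component)
    qed
    then show "cls U (x \<squnion>\<^bsub>P\<^esub> y) \<sqsubseteq>\<^bsub>Q U\<^esub> Z" unfolding z(2) using cls_le_iff[OF U xy z(1)] by blast
  qed (use cls_closed x y xy in blast)+
  from Q.L.sup_eqI[OF this] show ?thesis by (simp add: join_def)
qed

lemma cls_meet:
  assumes U: "U \<in> UF" and x: "x \<in> carrier P" and y: "y \<in> carrier P"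
  shows "cls U (x \<sqinter>\<^bsub>P\<^esub> y) = cls U x \<sqinter>\<^bsub>Q U\<^esub> cls U y"
proof -
  interpret Q: dense_compact_completion "Q U" "D U" "d U" by (rule ultraproduct_completion[OF U])
  have xy: "x \<sqinter>\<^bsub>P\<^esub> y \<in> carrier P" using x y by simp
  have "is_glb (Q U) (cls U (x \<sqinter>\<^bsub>P\<^esub> y)) {cls U x, cls U y}"
  proof (rule greatest_LowerI)
    fix X assume "X \<in> {cls U x, cls U y}"
    then show "cls U (x \<sqinter>\<^bsub>P\<^esub> y) \<sqsubseteq>\<^bsub>Q U\<^esub> X"
      using cls_mono[OF U xy x P.meet_left[OF x y]] cls_mono[OF U xy y P.meet_right[OF x y]] by blast
  next
    fix Z assume Z: "Z \<in> Lower (Q U) {cls U x, cls U y}"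
    then have "Z \<in> carrier (Q U)" by (simp add: Lower_def)
    then obtain z where z: "z \<in> carrier P" "Z = cls U z" unfolding carrier_ultraproduct by blast
    have "cls U z \<sqsubseteq>\<^bsub>Q U\<^esub> cls U x" "cls U z \<sqsubseteq>\<^bsub>Q U\<^esub> cls U y"
      using Lower_memD[OF Z] cls_closed[OF x] cls_closed[OF y] unfolding z(2) by simp_all
    then have "eventually (\<lambda>i. z i \<sqsubseteq>\<^bsub>L i\<^esub> x i) U" "eventually (\<lambda>i. z i \<sqsubseteq>\<^bsub>L i\<^esub> y i) U"
      using cls_le_iff[OF U] x y z(1) by blast+
    with ultrafilter_eventually_in[OF U] have "eventually (\<lambda>i. z i \<sqsubseteq>\<^bsub>L i\<^esub> (x \<sqinter>\<^bsub>P\<^esub> y) i) U"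
    proof eventually_elim
      case (elim i)
      interpret bounded_lattice "L i" by (rule factor_lattice[OF elim(1)])
      show ?case
        using meet_le[OF elim(2,3)] elim(1) x y z(1)
        by (simp add: meet_component product_component)
    qed
    then show "Z \<sqsubseteq>\<^bsub>Q U\<^esub> cls U (x \<sqinter>\<^bsub>P\<^esub> y)" unfolding z(2) using cls_le_iff[OF U z(1) xy] by blast
  qed (use cls_closed x y xy in blast)+
  from Q.L.inf_eqI[OF this] show ?thesis by (simp add: meet_def)
qed

lemma cls_bottom: "U \<in> UF \<Longrightarrow> cls U \<bottom>\<^bsub>P\<^esub> = \<bottom>\<^bsub>Q U\<^esub>"
proof -
  assume U: "U \<in> UF"
  interpret Q: dense_compact_completion "Q U" "D U" "d U" by (rule ultraproduct_completion[OF U])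
  show ?thesis
  proof (rule Q.L.bottom_eq[OF cls_closed[OF P.bottom_closed]])
    fix X assume "X \<in> carrier (Q U)"
    then obtain x where "x \<in> carrier P" "X = cls U x" unfolding carrier_ultraproduct by blast
    with cls_mono[OF U P.bottom_closed _ P.bottom_lower] show "cls U \<bottom>\<^bsub>P\<^esub> \<sqsubseteq>\<^bsub>Q U\<^esub> X" by blast
  qed
qed

lemma cls_top: "U \<in> UF \<Longrightarrow> cls U \<top>\<^bsub>P\<^esub> = \<top>\<^bsub>Q U\<^esub>"
proof -
  assume U: "U \<in> UF"
  interpret Q: dense_compact_completion "Q U" "D U" "d U" by (rule ultraproduct_completion[OF U])
  show ?thesis
  proof (rule Q.L.top_eq[OF cls_closed[OF P.top_closed]])
    fix X assume "X \<in> carrier (Q U)"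
    then obtain x where "x \<in> carrier P" "X = cls U x" unfolding carrier_ultraproduct by blast
    with cls_mono[OF U _ P.top_closed P.top_higher] show "X \<sqsubseteq>\<^bsub>Q U\<^esub> cls U \<top>\<^bsub>P\<^esub>" by blast
  qed
qed

text \<open>The quotient operation is a union over all lists of representatives; all of them give
  the same class, so the union collapses to it.\<close>

lemma cls_oper:
  assumes U: "U \<in> UF" and f: "f \<in> F" and as: "as \<in> carrier (power_lattice (ar f) P)"
  shows "oper (Q U) f (map (cls U) as) = cls U (oper P f as)"
proof -
  have as_P: "as ! k \<in> carrier P" if "k < length as" for k
    using as that by (simp add: mem_carrier_power)
  have oper_P: "oper P f bs \<in> carrier P" if "bs \<in> carrier (power_lattice (ar f) P)" for bs
    using lattice_based_algebra.oper_closed[OF product f that] .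
  have "cls U (oper P f bs) = cls U (oper P f as)" if "list_all2 (\<in>) bs (map (cls U) as)" for bs
  proof -
    have len: "length bs = length as" using list_all2_lengthD[OF that] by simp
    have bs: "bs ! k \<in> carrier P" "eventually (\<lambda>i. (as ! k) i = (bs ! k) i) U" if "k < length as" for k
    proof -
      have "bs ! k \<in> cls U (as ! k)"
        using list_all2_nthD2[OF \<open>list_all2 _ _ _\<close>, of k] that by simp
      then show "bs ! k \<in> carrier P" "eventually (\<lambda>i. (as ! k) i = (bs ! k) i) U"
        unfolding mem_ultraclass[OF U as_P[OF that]] by blast+
    qed
    have bs_P: "bs \<in> carrier (power_lattice (ar f) P)"
      using as bs(1) len by (simp add: mem_carrier_power)
    \<comment> \<open>Finiteness of the arity enters here: the agreement sets of the single
      arguments have to intersect in a member of \<open>U\<close>.\<close>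
    have "eventually (\<lambda>i. \<forall>k\<in>{..<length as}. (as ! k) i = (bs ! k) i) U"
      using bs(2) by (intro eventually_ball_finite) auto
    with ultrafilter_eventually_in[OF U] have "eventually (\<lambda>i. oper P f bs i = oper P f as i) U"
    proof eventually_elim
      case (elim i)
      then have "map (\<lambda>x. x i) bs = map (\<lambda>x. x i) as" using len by (simp add: list_eq_iff_nth_eq)
      with elim(1) show ?case by (simp add: product_oper)
    qed
    then show ?thesis by (rule ultraclass_eqI[OF U oper_P[OF bs_P] oper_P[OF as]])
  qed
  moreover have "list_all2 (\<in>) as (map (cls U) as)"
    using as_P by (simp add: list_all2_conv_all_nth mem_ultraclass[OF U] del: Image_singleton_iff)
  ultimately have "{cls U (oper P f bs) | bs. list_all2 (\<in>) bs (map (cls U) as)} =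
      {cls U (oper P f as)}" by blast
  then have "\<Union> {cls U (oper P f bs) | bs. list_all2 (\<in>) bs (map (cls U) as)} = cls U (oper P f as)"
    by (simp only: cSup_singleton)
  then show ?thesis unfolding ultraproduct_def quotient_algebra_def by simp
qed

text \<open>\<open>A\<close> need not lie in \<open>I\<close>: outside \<open>I\<close> elements of
  \<open>P\<close> are \<open>undefined\<close>, so the result stays extensional and
  \<open>A\<close> may be \<open>UNIV\<close> or an unrestricted comprehension.\<close>

definition glue :: "'i set \<Rightarrow> ('i \<Rightarrow> 'a) \<Rightarrow> ('i \<Rightarrow> 'a) \<Rightarrow> 'i \<Rightarrow> 'a" where
  "glue A x y = (\<lambda>i. if i \<in> A then x i else y i)"

lemma glue_closed: "x \<in> carrier P \<Longrightarrow> y \<in> carrier P \<Longrightarrow> glue A x y \<in> carrier P"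
  by (auto simp: mem_carrier_product glue_def PiE_def Pi_def extensional_def)

text \<open>Either \<open>A\<close> or its complement belongs to \<open>U\<close>, so exactly one of
  the two pieces is visible at \<open>U\<close>.\<close>

lemma cls_glue:
  assumes U: "U \<in> UF" and x: "x \<in> carrier P" and y: "y \<in> carrier P"
  shows "cls U (glue A x y) = (if eventually (\<lambda>i. i \<in> A) U then cls U x else cls U y)"
proof (cases "eventually (\<lambda>i. i \<in> A) U")
  case True
  then have "eventually (\<lambda>i. glue A x y i = x i) U" by eventually_elim (simp add: glue_def)
  with True ultraclass_eqI[OF U glue_closed[OF x y] x] show ?thesis by simp
next
  case False
  then have "eventually (\<lambda>i. i \<notin> A) U" using ultrafilter_eventually_not_iff[OF U] by blast
  then have "eventually (\<lambda>i. glue A x y i = y i) U" by eventually_elim (simp add: glue_def)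
  with False ultraclass_eqI[OF U glue_closed[OF x y] y] show ?thesis by simp
qed

section \<open>The map \<open>j\<close> and coordinatewise bounds in \<open>E\<close>\<close>

lemma j_component: "U \<in> UF \<Longrightarrow> j x U = d U (cls U x)"
  by (simp add: j_def)

lemma j_closed:
  assumes "x \<in> carrier P"
  shows "j x \<in> carrier E"
proof -
  have "d U (cls U x) \<in> carrier (D U)" if "U \<in> UF" for U
    by (rule dense_compact_completion.e_closed[OF ultraproduct_completion[OF that] cls_closed[OF assms]])
  then show ?thesis by (simp add: mem_carrier_product j_def)
qed

sublocale E: complete_lattice E
  by (rule complete_lattice_product[OF complete_D])

lemma image_j: "S \<subseteq> carrier P \<Longrightarrow> j ` S \<subseteq> carrier E"
  using j_closed by blast

lemma inf_j_component:
  assumes "S \<subseteq> carrier P" "U \<in> UF"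
  shows "(\<Sqinter>\<^bsub>E\<^esub>(j ` S)) U = \<Sqinter>\<^bsub>D U\<^esub>(d U ` cls U ` S)"
  using product_inf_component[where L = D, OF complete_D image_j[OF assms(1)] assms(2)]
  by (simp add: image_image j_component[OF assms(2)] del: Image_singleton_iff)

lemma sup_j_component:
  assumes "S \<subseteq> carrier P" "U \<in> UF"
  shows "(\<Squnion>\<^bsub>E\<^esub>(j ` S)) U = \<Squnion>\<^bsub>D U\<^esub>(d U ` cls U ` S)"
  using product_sup_component[where L = D, OF complete_D image_j[OF assms(1)] assms(2)]
  by (simp add: image_image j_component[OF assms(2)] del: Image_singleton_iff)

lemma image_cls: "S \<subseteq> carrier P \<Longrightarrow> cls U ` S \<subseteq> carrier (Q U)"
  using cls_closed by blast

section \<open>Closed and open elements concentrated at one coordinate\<close>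

lemma closed_component:
  assumes "p \<in> closed_elements P E j" "U \<in> UF"
  shows "p U \<in> closed_elements (Q U) (D U) (d U)"
proof -
  obtain S where S: "S \<subseteq> carrier P" "p = \<Sqinter>\<^bsub>E\<^esub>(j ` S)"
    using assms(1) unfolding closed_elements_def by blast
  then show ?thesis
    using inf_j_component[OF S(1) assms(2)] image_cls[OF S(1)] unfolding closed_elements_def by blast
qed

lemma open_component:
  assumes "p \<in> open_elements P E j" "U \<in> UF"
  shows "p U \<in> open_elements (Q U) (D U) (d U)"
proof -
  obtain S where S: "S \<subseteq> carrier P" "p = \<Squnion>\<^bsub>E\<^esub>(j ` S)"
    using assms(1) unfolding open_elements_def by blast
  then show ?thesis
    using sup_j_component[OF S(1) assms(2)] image_cls[OF S(1)] unfolding open_elements_def by blast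
qed

text \<open>At \<open>U\<close> the restriction to \<open>A\<close> is invisible, since
  \<open>A\<close> is a member of \<open>U\<close>, so the classes obtained are all elements above
  \<open>p\<close>. At any other \<open>V\<close> one element suffices: the top restricted to a set
  that is in \<open>U\<close> but not in \<open>V\<close> has class bottom.\<close>

lemma closed_bump:
  assumes U: "U \<in> UF" and p: "p \<in> closed_elements (Q U) (D U) (d U)"
  shows "(\<lambda>V\<in>UF. if V = U then p else \<bottom>\<^bsub>D V\<^esub>) \<in> closed_elements P E j"
proof -
  interpret Q: dense_compact_completion "Q U" "D U" "d U" by (rule ultraproduct_completion[OF U])
  have pc: "p \<in> carrier (D U)" by (rule Q.closed_element_in_carrier[OF p])
  let ?S = "{glue A s \<bottom>\<^bsub>P\<^esub> | A s. s \<in> carrier P \<and> p \<sqsubseteq>\<^bsub>D U\<^esub> d U (cls U s) \<and> eventually (\<lambda>i. i \<in> A) U}"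
  have S: "?S \<subseteq> carrier P" using glue_closed P.bottom_closed by blast
  have bot: "d V (cls V \<bottom>\<^bsub>P\<^esub>) = \<bottom>\<^bsub>D V\<^esub>" if "V \<in> UF" for V
    using dense_compact_completion.e_bottom[OF ultraproduct_completion[OF that]] cls_bottom[OF that] by simp
  have bump: "(\<lambda>V\<in>UF. if V = U then p else \<bottom>\<^bsub>D V\<^esub>) \<in> carrier E"
  proof -
    have "\<bottom>\<^bsub>D V\<^esub> \<in> carrier (D V)" if "V \<in> UF" for V
    proof -
      interpret complete_lattice "D V" by (rule complete_D[OF that])
      show ?thesis by simp
    qed
    with pc show ?thesis by (simp add: mem_carrier_product)
  qed
  have "\<Sqinter>\<^bsub>E\<^esub>(j ` ?S) = (\<lambda>V\<in>UF. if V = U then p else \<bottom>\<^bsub>D V\<^esub>)"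
  proof (rule product_eqI[OF E.inf_closed[OF image_j[OF S]] bump])
    fix V assume V: "V \<in> UF"
    show "(\<Sqinter>\<^bsub>E\<^esub>(j ` ?S)) V = (\<lambda>V\<in>UF. if V = U then p else \<bottom>\<^bsub>D V\<^esub>) V"
    proof (cases "V = U")
      case True
      have "cls U ` ?S = {b \<in> carrier (Q U). p \<sqsubseteq>\<^bsub>D U\<^esub> d U b}"
      proof (intro equalityI subsetI)
        fix b assume "b \<in> cls U ` ?S"
        then obtain A s where s: "s \<in> carrier P" "p \<sqsubseteq>\<^bsub>D U\<^esub> d U (cls U s)" "eventually (\<lambda>i. i \<in> A) U"
          "b = cls U (glue A s \<bottom>\<^bsub>P\<^esub>)" by blast
        then have b: "b = cls U s" using cls_glue[OF U s(1) P.bottom_closed] by simp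
        from cls_closed[OF s(1)] s(2) show "b \<in> {b \<in> carrier (Q U). p \<sqsubseteq>\<^bsub>D U\<^esub> d U b}"
          unfolding b by (intro CollectI conjI)
      next
        fix b assume "b \<in> {b \<in> carrier (Q U). p \<sqsubseteq>\<^bsub>D U\<^esub> d U b}"
        then obtain s where s: "s \<in> carrier P" "b = cls U s" "p \<sqsubseteq>\<^bsub>D U\<^esub> d U (cls U s)"
          unfolding carrier_ultraproduct by blast
        \<comment> \<open>Restriction to \<open>UNIV\<close> changes nothing, so every
          \<open>s\<close> whose class is above \<open>p\<close> belongs to the set itself.\<close>
        have "glue UNIV s \<bottom>\<^bsub>P\<^esub> = s" by (simp add: glue_def)
        moreover have "eventually (\<lambda>i. i \<in> UNIV) U" by simp
        ultimately have "s \<in> ?S" using s(1,3) by (intro CollectI exI[of _ UNIV] exI[of _ s]) simp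
        with s(2) show "b \<in> cls U ` ?S" by blast
      qed
      with Q.closed_element_eq_inf[OF p] show ?thesis
        using inf_j_component[OF S U] True U by simp
    next
      case False
      interpret DV: complete_lattice "D V" by (rule complete_D[OF V])
      obtain A where A: "eventually (\<lambda>i. i \<in> A) U" "\<not> eventually (\<lambda>i. i \<in> A) V"
        using ultrafilters_separated[OF U V] False by blast
      have "p \<sqsubseteq>\<^bsub>D U\<^esub> d U (cls U \<top>\<^bsub>P\<^esub>)"
        using pc by (simp add: cls_top[OF U] Q.e_top)
      with A(1) have g: "glue A \<top>\<^bsub>P\<^esub> \<bottom>\<^bsub>P\<^esub> \<in> ?S"
        using P.top_closed by blast
      have "j (glue A \<top>\<^bsub>P\<^esub> \<bottom>\<^bsub>P\<^esub>) V = \<bottom>\<^bsub>D V\<^esub>"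
        using A(2) by (simp add: j_component[OF V] cls_glue[OF V] bot[OF V])
      moreover have "(\<Sqinter>\<^bsub>E\<^esub>(j ` ?S)) V \<sqsubseteq>\<^bsub>D V\<^esub> j (glue A \<top>\<^bsub>P\<^esub> \<bottom>\<^bsub>P\<^esub>) V"
        using E.inf_lower[OF image_j[OF S] imageI[OF g]] V unfolding product_le_iff by (rule bspec)
      ultimately have le: "(\<Sqinter>\<^bsub>E\<^esub>(j ` ?S)) V \<sqsubseteq>\<^bsub>D V\<^esub> \<bottom>\<^bsub>D V\<^esub>" by (simp only:)
      have c: "(\<Sqinter>\<^bsub>E\<^esub>(j ` ?S)) V \<in> carrier (D V)"
        by (rule product_component[OF E.inf_closed[OF image_j[OF S]] V])
      have "(\<Sqinter>\<^bsub>E\<^esub>(j ` ?S)) V = \<bottom>\<^bsub>D V\<^esub>"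
        by (rule DV.le_antisym[OF le DV.bottom_lower[OF c] c DV.bottom_closed])
      with False V show ?thesis by simp
    qed
  qed
  from this[symmetric] S show ?thesis
    unfolding closed_elements_def by (intro CollectI exI[of _ ?S] conjI)
qed

text \<open>As for \<open>closed_bump\<close> with the orders reversed: the filling value off
  \<open>A\<close> is the top, which forces the join to be the top at all coordinates other than
  \<open>U\<close>.\<close>

lemma open_bump:
  assumes U: "U \<in> UF" and p: "p \<in> open_elements (Q U) (D U) (d U)"
  shows "(\<lambda>V\<in>UF. if V = U then p else \<top>\<^bsub>D V\<^esub>) \<in> open_elements P E j"
proof -
  interpret Q: dense_compact_completion "Q U" "D U" "d U" by (rule ultraproduct_completion[OF U])
  have pc: "p \<in> carrier (D U)" by (rule Q.open_element_in_carrier[OF p])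
  let ?S = "{glue A s \<top>\<^bsub>P\<^esub> | A s. s \<in> carrier P \<and> d U (cls U s) \<sqsubseteq>\<^bsub>D U\<^esub> p \<and> eventually (\<lambda>i. i \<in> A) U}"
  have S: "?S \<subseteq> carrier P" using glue_closed P.top_closed by blast
  have bot: "d V (cls V \<top>\<^bsub>P\<^esub>) = \<top>\<^bsub>D V\<^esub>" if "V \<in> UF" for V
    using dense_compact_completion.e_top[OF ultraproduct_completion[OF that]] cls_top[OF that] by simp
  have bump: "(\<lambda>V\<in>UF. if V = U then p else \<top>\<^bsub>D V\<^esub>) \<in> carrier E"
  proof -
    have "\<top>\<^bsub>D V\<^esub> \<in> carrier (D V)" if "V \<in> UF" for V
    proof -
      interpret complete_lattice "D V" by (rule complete_D[OF that])
      show ?thesis by simp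
    qed
    with pc show ?thesis by (simp add: mem_carrier_product)
  qed
  have "\<Squnion>\<^bsub>E\<^esub>(j ` ?S) = (\<lambda>V\<in>UF. if V = U then p else \<top>\<^bsub>D V\<^esub>)"
  proof (rule product_eqI[OF E.sup_closed[OF image_j[OF S]] bump])
    fix V assume V: "V \<in> UF"
    show "(\<Squnion>\<^bsub>E\<^esub>(j ` ?S)) V = (\<lambda>V\<in>UF. if V = U then p else \<top>\<^bsub>D V\<^esub>) V"
    proof (cases "V = U")
      case True
      have "cls U ` ?S = {b \<in> carrier (Q U). d U b \<sqsubseteq>\<^bsub>D U\<^esub> p}"
      proof (intro equalityI subsetI)
        fix b assume "b \<in> cls U ` ?S"
        then obtain A s where s: "s \<in> carrier P" "d U (cls U s) \<sqsubseteq>\<^bsub>D U\<^esub> p" "eventually (\<lambda>i. i \<in> A) U"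
          "b = cls U (glue A s \<top>\<^bsub>P\<^esub>)" by blast
        then have b: "b = cls U s" using cls_glue[OF U s(1) P.top_closed] by simp
        from cls_closed[OF s(1)] s(2) show "b \<in> {b \<in> carrier (Q U). d U b \<sqsubseteq>\<^bsub>D U\<^esub> p}"
          unfolding b by (intro CollectI conjI)
      next
        fix b assume "b \<in> {b \<in> carrier (Q U). d U b \<sqsubseteq>\<^bsub>D U\<^esub> p}"
        then obtain s where s: "s \<in> carrier P" "b = cls U s" "d U (cls U s) \<sqsubseteq>\<^bsub>D U\<^esub> p"
          unfolding carrier_ultraproduct by blast
        have "glue UNIV s \<top>\<^bsub>P\<^esub> = s" by (simp add: glue_def)
        moreover have "eventually (\<lambda>i. i \<in> UNIV) U" by simp
        ultimately have "s \<in> ?S" using s(1,3) by (intro CollectI exI[of _ UNIV] exI[of _ s]) simp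
        with s(2) show "b \<in> cls U ` ?S" by blast
      qed
      with Q.open_element_eq_sup[OF p] show ?thesis
        using sup_j_component[OF S U] True U by simp
    next
      case False
      interpret DV: complete_lattice "D V" by (rule complete_D[OF V])
      obtain A where A: "eventually (\<lambda>i. i \<in> A) U" "\<not> eventually (\<lambda>i. i \<in> A) V"
        using ultrafilters_separated[OF U V] False by blast
      have "d U (cls U \<bottom>\<^bsub>P\<^esub>) \<sqsubseteq>\<^bsub>D U\<^esub> p"
        using pc by (simp add: cls_bottom[OF U] Q.e_bottom)
      with A(1) have g: "glue A \<bottom>\<^bsub>P\<^esub> \<top>\<^bsub>P\<^esub> \<in> ?S"
        using P.bottom_closed by blast
      have "j (glue A \<bottom>\<^bsub>P\<^esub> \<top>\<^bsub>P\<^esub>) V = \<top>\<^bsub>D V\<^esub>"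
        using A(2) by (simp add: j_component[OF V] cls_glue[OF V] bot[OF V])
      moreover have "j (glue A \<bottom>\<^bsub>P\<^esub> \<top>\<^bsub>P\<^esub>) V \<sqsubseteq>\<^bsub>D V\<^esub> (\<Squnion>\<^bsub>E\<^esub>(j ` ?S)) V"
        using E.sup_upper[OF image_j[OF S] imageI[OF g]] V unfolding product_le_iff by (rule bspec)
      ultimately have le: "\<top>\<^bsub>D V\<^esub> \<sqsubseteq>\<^bsub>D V\<^esub> (\<Squnion>\<^bsub>E\<^esub>(j ` ?S)) V" by (simp only:)
      have c: "(\<Squnion>\<^bsub>E\<^esub>(j ` ?S)) V \<in> carrier (D V)"
        by (rule product_component[OF E.sup_closed[OF image_j[OF S]] V])
      have "(\<Squnion>\<^bsub>E\<^esub>(j ` ?S)) V = \<top>\<^bsub>D V\<^esub>"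
        by (rule DV.le_antisym[OF DV.top_higher[OF c] le c DV.top_closed])
      with False V show ?thesis by simp
    qed
  qed
  from this[symmetric] S show ?thesis
    unfolding open_elements_def by (intro CollectI exI[of _ ?S] conjI)
qed

text \<open>These elements test a single coordinate. Density of \<open>E\<close> and the lifting of
  closed elements from a coordinate both reduce to this equivalence.\<close>

lemma bump_closed_le_iff:
  assumes U: "U \<in> UF" and x: "x \<in> carrier E"
  shows "(\<lambda>V\<in>UF. if V = U then p else \<bottom>\<^bsub>D V\<^esub>) \<sqsubseteq>\<^bsub>E\<^esub> x \<longleftrightarrow> p \<sqsubseteq>\<^bsub>D U\<^esub> x U"
proof -
  have "\<bottom>\<^bsub>D V\<^esub> \<sqsubseteq>\<^bsub>D V\<^esub> x V" if "V \<in> UF" for V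
  proof -
    interpret complete_lattice "D V" by (rule complete_D[OF that])
    show ?thesis by (rule bottom_lower[OF product_component[OF x that]])
  qed
  then show ?thesis using U by (simp add: product_le_iff)
qed

lemma le_bump_open_iff:
  assumes U: "U \<in> UF" and x: "x \<in> carrier E"
  shows "x \<sqsubseteq>\<^bsub>E\<^esub> (\<lambda>V\<in>UF. if V = U then q else \<top>\<^bsub>D V\<^esub>) \<longleftrightarrow> x U \<sqsubseteq>\<^bsub>D U\<^esub> q"
proof -
  have "x V \<sqsubseteq>\<^bsub>D V\<^esub> \<top>\<^bsub>D V\<^esub>" if "V \<in> UF" for V
  proof -
    interpret complete_lattice "D V" by (rule complete_D[OF that])
    show ?thesis by (rule top_higher[OF product_component[OF x that]])
  qed
  then show ?thesis using U by (simp add: product_le_iff)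
qed

lemma j_embedding: "lattice_embedding P E j"
proof -
  have "j (x \<squnion>\<^bsub>P\<^esub> y) = j x \<squnion>\<^bsub>E\<^esub> j y" if x: "x \<in> carrier P" and y: "y \<in> carrier P" for x y
  proof (rule product_eqI[OF j_closed[OF P.join_closed[OF x y]]
        E.join_closed[OF j_closed[OF x] j_closed[OF y]]])
    fix U assume U: "U \<in> UF"
    interpret Q: dense_compact_completion "Q U" "D U" "d U" by (rule ultraproduct_completion[OF U])
    have "(j x \<squnion>\<^bsub>E\<^esub> j y) U = d U (cls U x) \<squnion>\<^bsub>D U\<^esub> d U (cls U y)"
      using sup_j_component[of "{x, y}", OF _ U] x y by (simp add: join_def)
    then show "j (x \<squnion>\<^bsub>P\<^esub> y) U = (j x \<squnion>\<^bsub>E\<^esub> j y) U"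
      using Q.e_join[OF cls_closed[OF x] cls_closed[OF y]]
      by (simp add: j_component[OF U] cls_join[OF U x y] del: Image_singleton_iff)
  qed
  moreover have "j (x \<sqinter>\<^bsub>P\<^esub> y) = j x \<sqinter>\<^bsub>E\<^esub> j y" if x: "x \<in> carrier P" and y: "y \<in> carrier P" for x y
  proof (rule product_eqI[OF j_closed[OF P.meet_closed[OF x y]]
        E.meet_closed[OF j_closed[OF x] j_closed[OF y]]])
    fix U assume U: "U \<in> UF"
    interpret Q: dense_compact_completion "Q U" "D U" "d U" by (rule ultraproduct_completion[OF U])
    have "(j x \<sqinter>\<^bsub>E\<^esub> j y) U = d U (cls U x) \<sqinter>\<^bsub>D U\<^esub> d U (cls U y)"
      using inf_j_component[of "{x, y}", OF _ U] x y by (simp add: meet_def)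
    then show "j (x \<sqinter>\<^bsub>P\<^esub> y) U = (j x \<sqinter>\<^bsub>E\<^esub> j y) U"
      using Q.e_meet[OF cls_closed[OF x] cls_closed[OF y]]
      by (simp add: j_component[OF U] cls_meet[OF U x y] del: Image_singleton_iff)
  qed
  moreover have "j \<bottom>\<^bsub>P\<^esub> = \<bottom>\<^bsub>E\<^esub>"
  proof (rule bounded_lattice.bottom_eq[OF E.bounded_lattice j_closed[OF P.bottom_closed]])
    fix x assume x: "x \<in> carrier E"
    show "j \<bottom>\<^bsub>P\<^esub> \<sqsubseteq>\<^bsub>E\<^esub> x"
      unfolding product_le_iff
    proof
      fix U assume U: "U \<in> UF"
      interpret Q: dense_compact_completion "Q U" "D U" "d U" by (rule ultraproduct_completion[OF U])
      show "j \<bottom>\<^bsub>P\<^esub> U \<sqsubseteq>\<^bsub>D U\<^esub> x U"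
        using product_component[OF x U] by (simp add: j_component[OF U] cls_bottom[OF U] Q.e_bottom)
    qed
  qed
  moreover have "j \<top>\<^bsub>P\<^esub> = \<top>\<^bsub>E\<^esub>"
  proof (rule bounded_lattice.top_eq[OF E.bounded_lattice j_closed[OF P.top_closed]])
    fix x assume x: "x \<in> carrier E"
    show "x \<sqsubseteq>\<^bsub>E\<^esub> j \<top>\<^bsub>P\<^esub>"
      unfolding product_le_iff
    proof
      fix U assume U: "U \<in> UF"
      interpret Q: dense_compact_completion "Q U" "D U" "d U" by (rule ultraproduct_completion[OF U])
      show "x U \<sqsubseteq>\<^bsub>D U\<^esub> j \<top>\<^bsub>P\<^esub> U"
        using product_component[OF x U] by (simp add: j_component[OF U] cls_top[OF U] Q.e_top)
    qed
  qed
  moreover have "inj_on j (carrier P)"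
  proof (rule inj_onI)
    fix x y assume x: "x \<in> carrier P" and y: "y \<in> carrier P" and eq: "j x = j y"
    show "x = y"
    proof (rule product_eqI[OF x y])
      fix i assume "i \<in> I"
      \<comment> \<open>The principal ultrafilter at \<open>i\<close> recovers the coordinate
        \<open>i\<close>: two elements have the same class there iff they agree at
        \<open>i\<close>.\<close>
      then have U: "principal {i} \<in> UF" by (rule principal_ultrafilter)
      interpret Q: dense_compact_completion "Q (principal {i})" "D (principal {i})" "d (principal {i})"
        by (rule ultraproduct_completion[OF U])
      have "cls (principal {i}) x = cls (principal {i}) y"
        using fun_cong[OF eq, of "principal {i}"] Q.e_inj cls_closed x y
        by (simp add: j_component[OF U] inj_on_eq_iff del: Image_singleton_iff)
      moreover have "y \<in> cls (principal {i}) y" unfolding mem_ultraclass[OF U y] using y by simp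
      ultimately have "y \<in> cls (principal {i}) x" by simp
      then show "x i = y i" unfolding mem_ultraclass[OF U x] by (simp add: eventually_principal)
    qed
  qed
  ultimately show ?thesis
    using j_closed P.lattice_axioms E.lattice_axioms
    unfolding lattice_embedding_def bounded_lattice_hom_def join_pres_def meet_pres_def by blast
qed

section \<open>Compactness and density of \<open>E\<close>\<close>

lemma inf_closed_P: "finite S \<Longrightarrow> S \<subseteq> carrier P \<Longrightarrow> \<Sqinter>\<^bsub>P\<^esub>S \<in> carrier P"
  by (rule greatest_closed[OF P.finite_inf_glb])

lemma sup_closed_P: "finite S \<Longrightarrow> S \<subseteq> carrier P \<Longrightarrow> \<Squnion>\<^bsub>P\<^esub>S \<in> carrier P"
  by (rule least_closed[OF P.finite_sup_lub])

lemma inf_P_anti_mono: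
  assumes "finite T" "T \<subseteq> carrier P" "S \<subseteq> T"
  shows "\<Sqinter>\<^bsub>P\<^esub>T \<sqsubseteq>\<^bsub>P\<^esub> \<Sqinter>\<^bsub>P\<^esub>S"
proof (rule greatest_le[OF P.finite_inf_glb])
  show "\<Sqinter>\<^bsub>P\<^esub>T \<in> Lower P S"
    using greatest_mem[OF P.finite_inf_glb[OF assms(1,2)]] Lower_antimono[OF assms(3)] by blast
qed (use assms finite_subset in blast)+

lemma sup_P_mono:
  assumes "finite T" "T \<subseteq> carrier P" "S \<subseteq> T"
  shows "\<Squnion>\<^bsub>P\<^esub>S \<sqsubseteq>\<^bsub>P\<^esub> \<Squnion>\<^bsub>P\<^esub>T"
proof (rule least_le[OF P.finite_sup_lub])
  show "\<Squnion>\<^bsub>P\<^esub>T \<in> Upper P S"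
    using least_mem[OF P.finite_sup_lub[OF assms(1,2)]] Upper_antimono[OF assms(3)] by blast
qed (use assms finite_subset in blast)+

text \<open>Passes from a finite meet of classes, as supplied by compactness at \<open>U\<close>, to
  the class of a finite meet in \<open>P\<close>, which can be evaluated at each index.\<close>

lemma cls_inf_le:
  assumes U: "U \<in> UF" and S: "finite S" "S \<subseteq> carrier P"
  shows "cls U (\<Sqinter>\<^bsub>P\<^esub>S) \<sqsubseteq>\<^bsub>Q U\<^esub> \<Sqinter>\<^bsub>Q U\<^esub>(cls U ` S)"
proof -
  interpret Q: dense_compact_completion "Q U" "D U" "d U" by (rule ultraproduct_completion[OF U])
  show ?thesis
  proof (rule greatest_le[OF Q.L.finite_inf_glb[OF finite_imageI[OF S(1)] image_cls[OF S(2)]]],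
      rule Lower_memI[OF _ cls_closed[OF inf_closed_P[OF S]]])
    fix X assume "X \<in> cls U ` S"
    then obtain s where s: "s \<in> S" "X = cls U s" by blast
    have "\<Sqinter>\<^bsub>P\<^esub>S \<sqsubseteq>\<^bsub>P\<^esub> s" by (rule greatest_Lower_below[OF P.finite_inf_glb[OF S] s(1) S(2)])
    then show "cls U (\<Sqinter>\<^bsub>P\<^esub>S) \<sqsubseteq>\<^bsub>Q U\<^esub> X"
      unfolding s(2) using s(1) S(2) by (intro cls_mono[OF U inf_closed_P[OF S]]) blast
  qed
qed

lemma le_cls_sup:
  assumes U: "U \<in> UF" and S: "finite S" "S \<subseteq> carrier P"
  shows "\<Squnion>\<^bsub>Q U\<^esub>(cls U ` S) \<sqsubseteq>\<^bsub>Q U\<^esub> cls U (\<Squnion>\<^bsub>P\<^esub>S)"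
proof -
  interpret Q: dense_compact_completion "Q U" "D U" "d U" by (rule ultraproduct_completion[OF U])
  show ?thesis
  proof (rule least_le[OF Q.L.finite_sup_lub[OF finite_imageI[OF S(1)] image_cls[OF S(2)]]],
      rule Upper_memI[OF _ cls_closed[OF sup_closed_P[OF S]]])
    fix X assume "X \<in> cls U ` S"
    then obtain s where s: "s \<in> S" "X = cls U s" by blast
    have "s \<sqsubseteq>\<^bsub>P\<^esub> \<Squnion>\<^bsub>P\<^esub>S" by (rule least_Upper_above[OF P.finite_sup_lub[OF S] s(1) S(2)])
    then show "X \<sqsubseteq>\<^bsub>Q U\<^esub> cls U (\<Squnion>\<^bsub>P\<^esub>S)"
      unfolding s(2) using s(1) S(2) by (intro cls_mono[OF U _ sup_closed_P[OF S]]) blast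
  qed
qed

text \<open>Compactness at each \<open>U\<close> yields finite \<open>S'\<close> and
  \<open>T'\<close> whose inequality holds on a member of \<open>U\<close>. Finitely many of these
  sets cover \<open>I\<close> by \<open>ultrafilters_compact\<close>, so finitely many pairs of
  finite sets suffice.\<close>

lemma j_compact:
  assumes S: "S \<subseteq> carrier P" and T: "T \<subseteq> carrier P"
    and le: "\<Sqinter>\<^bsub>E\<^esub>(j ` S) \<sqsubseteq>\<^bsub>E\<^esub> \<Squnion>\<^bsub>E\<^esub>(j ` T)"
  shows "\<exists>S' T'. finite S' \<and> S' \<subseteq> S \<and> finite T' \<and> T' \<subseteq> T \<and> \<Sqinter>\<^bsub>P\<^esub>S' \<sqsubseteq>\<^bsub>P\<^esub> \<Squnion>\<^bsub>P\<^esub>T'"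
proof -
  let ?fin = "\<lambda>(S', T'). finite S' \<and> S' \<subseteq> S \<and> finite T' \<and> T' \<subseteq> T"
  let ?B = "\<lambda>(S', T'). {i. (\<Sqinter>\<^bsub>P\<^esub>S') i \<sqsubseteq>\<^bsub>L i\<^esub> (\<Squnion>\<^bsub>P\<^esub>T') i}"
  have "\<exists>A\<in>?B ` Collect ?fin. eventually (\<lambda>i. i \<in> A) U" if U: "U \<in> UF" for U
  proof -
    interpret Q: dense_compact_completion "Q U" "D U" "d U" by (rule ultraproduct_completion[OF U])
    have "\<Sqinter>\<^bsub>D U\<^esub>(d U ` cls U ` S) \<sqsubseteq>\<^bsub>D U\<^esub> \<Squnion>\<^bsub>D U\<^esub>(d U ` cls U ` T)"
      using le U unfolding product_le_iff inf_j_component[OF S U, symmetric] sup_j_component[OF T U, symmetric]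
      by (rule bspec)
    from Q.compact[OF image_cls[OF S] image_cls[OF T] this] obtain X Y where
      XY: "finite X" "X \<subseteq> cls U ` S" "finite Y" "Y \<subseteq> cls U ` T" "\<Sqinter>\<^bsub>Q U\<^esub>X \<sqsubseteq>\<^bsub>Q U\<^esub> \<Squnion>\<^bsub>Q U\<^esub>Y" by blast
    from finite_subset_image[OF XY(1,2)] obtain S' where S': "S' \<subseteq> S" "finite S'" "X = cls U ` S'" by blast
    from finite_subset_image[OF XY(3,4)] obtain T' where T': "T' \<subseteq> T" "finite T'" "Y = cls U ` T'" by blast
    have SP: "S' \<subseteq> carrier P" "T' \<subseteq> carrier P" using S' T' S T by blast+
    have c: "\<Sqinter>\<^bsub>Q U\<^esub>X \<in> carrier (Q U)" "\<Squnion>\<^bsub>Q U\<^esub>Y \<in> carrier (Q U)"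
      using greatest_closed[OF Q.L.finite_inf_glb[OF XY(1)]] least_closed[OF Q.L.finite_sup_lub[OF XY(3)]]
        image_cls[OF SP(1)] image_cls[OF SP(2)] S'(3) T'(3) by blast+
    note cl = cls_closed[OF inf_closed_P[OF S'(2) SP(1)], of U] cls_closed[OF sup_closed_P[OF T'(2) SP(2)], of U]
    have "cls U (\<Sqinter>\<^bsub>P\<^esub>S') \<sqsubseteq>\<^bsub>Q U\<^esub> \<Squnion>\<^bsub>Q U\<^esub>Y"
      by (rule Q.L.le_trans[OF cls_inf_le[OF U S'(2) SP(1), folded S'(3)] XY(5) cl(1) c])
    then have "cls U (\<Sqinter>\<^bsub>P\<^esub>S') \<sqsubseteq>\<^bsub>Q U\<^esub> cls U (\<Squnion>\<^bsub>P\<^esub>T')"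
      by (rule Q.L.le_trans[OF _ le_cls_sup[OF U T'(2) SP(2), folded T'(3)] cl(1) c(2) cl(2)])
    then have "eventually (\<lambda>i. i \<in> ?B (S', T')) U"
      unfolding cls_le_iff[OF U inf_closed_P[OF S'(2) SP(1)] sup_closed_P[OF T'(2) SP(2)]] by simp
    moreover have "(S', T') \<in> Collect ?fin" using S' T' by simp
    ultimately show ?thesis by (rule bexI[OF _ imageI])
  qed
  then obtain \<B> where \<B>: "\<B> \<subseteq> ?B ` Collect ?fin" "finite \<B>" "I \<subseteq> \<Union>\<B>"
    by (rule ultrafilters_compact)
  from finite_subset_image[OF \<B>(2,1)] obtain \<Z> where
    Z: "\<Z> \<subseteq> Collect ?fin" "finite \<Z>" "\<B> = ?B ` \<Z>" by blast
  \<comment> \<open>The unions work at every index at once: enlarging \<open>S'\<close> lowers its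
    meet and enlarging \<open>T'\<close> raises its join, so the inequality of the pair responsible
    for \<open>i\<close> persists.\<close>
  let ?S = "\<Union>(fst ` \<Z>)" and ?T = "\<Union>(snd ` \<Z>)"
  have fin: "finite (fst z)" "fst z \<subseteq> S" "finite (snd z)" "snd z \<subseteq> T" if "z \<in> \<Z>" for z
    using subsetD[OF Z(1) that] by (simp_all add: case_prod_beta)
  have S': "finite ?S" "?S \<subseteq> S" and T': "finite ?T" "?T \<subseteq> T" using fin Z(2) by blast+
  have SP: "?S \<subseteq> carrier P" "?T \<subseteq> carrier P" using S'(2) T'(2) S T by blast+
  have "\<Sqinter>\<^bsub>P\<^esub>?S \<sqsubseteq>\<^bsub>P\<^esub> \<Squnion>\<^bsub>P\<^esub>?T"
    unfolding product_le_iff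
  proof
    fix i assume i: "i \<in> I"
    interpret Li: bounded_lattice "L i" by (rule factor_lattice[OF i])
    from i \<B>(3) Z(3) obtain z where z: "z \<in> \<Z>" "i \<in> ?B z" by blast
    have sub: "fst z \<subseteq> ?S" "snd z \<subseteq> ?T" using z(1) by blast+
    have zc: "\<Sqinter>\<^bsub>P\<^esub>(fst z) \<in> carrier P" "\<Squnion>\<^bsub>P\<^esub>(snd z) \<in> carrier P"
      using inf_closed_P[OF fin(1)[OF z(1)]] sup_closed_P[OF fin(3)[OF z(1)]] sub SP by blast+
    have "(\<Sqinter>\<^bsub>P\<^esub>?S) i \<sqsubseteq>\<^bsub>L i\<^esub> (\<Sqinter>\<^bsub>P\<^esub>(fst z)) i"
      using inf_P_anti_mono[OF S'(1) SP(1) sub(1)] i unfolding product_le_iff by blast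
    moreover have "(\<Squnion>\<^bsub>P\<^esub>(snd z)) i \<sqsubseteq>\<^bsub>L i\<^esub> (\<Squnion>\<^bsub>P\<^esub>?T) i"
      using sup_P_mono[OF T'(1) SP(2) sub(2)] i unfolding product_le_iff by blast
    moreover have "(\<Sqinter>\<^bsub>P\<^esub>(fst z)) i \<sqsubseteq>\<^bsub>L i\<^esub> (\<Squnion>\<^bsub>P\<^esub>(snd z)) i"
      using z(2) by (simp add: case_prod_beta)
    ultimately show "(\<Sqinter>\<^bsub>P\<^esub>?S) i \<sqsubseteq>\<^bsub>L i\<^esub> (\<Squnion>\<^bsub>P\<^esub>?T) i"
      using product_component[OF zc(1) i] product_component[OF zc(2) i]
        product_component[OF inf_closed_P[OF S'(1) SP(1)] i]
        product_component[OF sup_closed_P[OF T'(1) SP(2)] i] Li.le_trans by metis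
  qed
  with S' T' show ?thesis by blast
qed

text \<open>Density is shown in its separation form, where the elements concentrated at
  \<open>U\<close> reduce it to density of the canonical extension at \<open>U\<close>.\<close>

sublocale E: dense_compact_completion P E j
proof
  show "lattice_embedding P E j" by (rule j_embedding)
  show "\<exists>S' T'. finite S' \<and> S' \<subseteq> S \<and> finite T' \<and> T' \<subseteq> T \<and> \<Sqinter>\<^bsub>P\<^esub>S' \<sqsubseteq>\<^bsub>P\<^esub> \<Squnion>\<^bsub>P\<^esub>T'"
    if "S \<subseteq> carrier P" "T \<subseteq> carrier P" "\<Sqinter>\<^bsub>E\<^esub>(j ` S) \<sqsubseteq>\<^bsub>E\<^esub> \<Squnion>\<^bsub>E\<^esub>(j ` T)" for S T
    using that by (rule j_compact)
  fix x assume x: "x \<in> carrier E"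
  show "\<exists>K. K \<subseteq> closed_elements P E j \<and> x = \<Squnion>\<^bsub>E\<^esub>K"
  proof (rule E.sup_of_lower_sets[OF _ _ x])
    show "closed_elements P E j \<subseteq> carrier E"
      unfolding closed_elements_def using E.inf_closed[OF image_j] by blast
    fix x y assume x: "x \<in> carrier E" and y: "y \<in> carrier E"
      and le: "\<forall>p\<in>closed_elements P E j. p \<sqsubseteq>\<^bsub>E\<^esub> x \<longrightarrow> p \<sqsubseteq>\<^bsub>E\<^esub> y"
    show "x \<sqsubseteq>\<^bsub>E\<^esub> y"
      unfolding product_le_iff
    proof
      fix U assume U: "U \<in> UF"
      interpret Q: dense_compact_completion "Q U" "D U" "d U" by (rule ultraproduct_completion[OF U])
      show "x U \<sqsubseteq>\<^bsub>D U\<^esub> y U"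
      proof (rule Q.le_by_closed[OF product_component[OF x U] product_component[OF y U]])
        fix S assume S: "S \<subseteq> carrier (Q U)" "\<Sqinter>\<^bsub>D U\<^esub>(d U ` S) \<sqsubseteq>\<^bsub>D U\<^esub> x U"
        then have "\<Sqinter>\<^bsub>D U\<^esub>(d U ` S) \<in> closed_elements (Q U) (D U) (d U)"
          unfolding closed_elements_def by blast
        from le[rule_format, OF closed_bump[OF U this]] S(2) show "\<Sqinter>\<^bsub>D U\<^esub>(d U ` S) \<sqsubseteq>\<^bsub>D U\<^esub> y U"
          unfolding bump_closed_le_iff[OF U x] bump_closed_le_iff[OF U y] by blast
      qed
    qed
  qed
  show "\<exists>K. K \<subseteq> open_elements P E j \<and> x = \<Sqinter>\<^bsub>E\<^esub>K"
  proof (rule E.inf_of_upper_sets[OF _ _ x])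
    show "open_elements P E j \<subseteq> carrier E"
      unfolding open_elements_def using E.sup_closed[OF image_j] by blast
    fix x y assume x: "x \<in> carrier E" and y: "y \<in> carrier E"
      and le: "\<forall>p\<in>open_elements P E j. y \<sqsubseteq>\<^bsub>E\<^esub> p \<longrightarrow> x \<sqsubseteq>\<^bsub>E\<^esub> p"
    show "x \<sqsubseteq>\<^bsub>E\<^esub> y"
      unfolding product_le_iff
    proof
      fix U assume U: "U \<in> UF"
      interpret Q: dense_compact_completion "Q U" "D U" "d U" by (rule ultraproduct_completion[OF U])
      show "x U \<sqsubseteq>\<^bsub>D U\<^esub> y U"
      proof (rule Q.le_by_open[OF product_component[OF x U] product_component[OF y U]])
        fix S assume S: "S \<subseteq> carrier (Q U)" "y U \<sqsubseteq>\<^bsub>D U\<^esub> \<Squnion>\<^bsub>D U\<^esub>(d U ` S)"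
        then have "\<Squnion>\<^bsub>D U\<^esub>(d U ` S) \<in> open_elements (Q U) (D U) (d U)"
          unfolding open_elements_def by blast
        from le[rule_format, OF open_bump[OF U this]] S(2) show "x U \<sqsubseteq>\<^bsub>D U\<^esub> \<Squnion>\<^bsub>D U\<^esub>(d U ` S)"
          unfolding le_bump_open_iff[OF U x] le_bump_open_iff[OF U y] by blast
      qed
    qed
  qed
qed

section \<open>Intervals at one coordinate and the added operations\<close>

lemma component_interpolation:
  assumes U: "U \<in> UF" and x: "x \<in> carrier E"
    and p: "p \<in> closed_elements P E j" "p \<sqsubseteq>\<^bsub>E\<^esub> x"
    and q: "q \<in> open_elements P E j" "x \<sqsubseteq>\<^bsub>E\<^esub> q"
    and b: "b \<in> carrier (Q U)" "p U \<sqsubseteq>\<^bsub>D U\<^esub> d U b" "d U b \<sqsubseteq>\<^bsub>D U\<^esub> q U"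
  shows "\<exists>a. a \<in> carrier P \<and> cls U a = b \<and> p \<sqsubseteq>\<^bsub>E\<^esub> j a \<and> j a \<sqsubseteq>\<^bsub>E\<^esub> q"
proof -
  interpret Q: dense_compact_completion "Q U" "D U" "d U" by (rule ultraproduct_completion[OF U])
  obtain S where S: "S \<subseteq> carrier P" "p = \<Sqinter>\<^bsub>E\<^esub>(j ` S)"
    using p(1) unfolding closed_elements_def by blast
  obtain T where T: "T \<subseteq> carrier P" "q = \<Squnion>\<^bsub>E\<^esub>(j ` T)"
    using q(1) unfolding open_elements_def by blast
  have pE: "p \<in> carrier E" by (rule E.closed_element_in_carrier[OF p(1)])
  have qE: "q \<in> carrier E" by (rule E.open_element_in_carrier[OF q(1)])
  have "p \<sqsubseteq>\<^bsub>E\<^esub> q" by (rule E.le_trans[OF p(2) q(2) pE x qE])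
  \<comment> \<open>Compactness of \<open>E\<close> as a whole supplies \<open>c\<close>, the value
    to be used where the representative of \<open>b\<close> fails to lie between the bounds.\<close>
  from E.between_closed_open[OF S(1) T(1) this[unfolded S(2) T(2)], folded S(2) T(2)]
  obtain c where c: "c \<in> carrier P" "p \<sqsubseteq>\<^bsub>E\<^esub> j c" "j c \<sqsubseteq>\<^bsub>E\<^esub> q" by blast
  from b(1) obtain a where a: "a \<in> carrier P" "b = cls U a" unfolding carrier_ultraproduct by blast
  \<comment> \<open>Infinitely many members of \<open>S\<close> need not be below the representative
    on a common member of \<open>U\<close>. Compactness at \<open>U\<close> leaves finitely many,
    and their meet in \<open>P\<close> bounds the representative almost everywhere.\<close>
  obtain X where X: "finite X" "X \<subseteq> cls U ` S" "\<Sqinter>\<^bsub>Q U\<^esub>X \<sqsubseteq>\<^bsub>Q U\<^esub> b"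
    by (rule Q.finite_inf_below[OF image_cls[OF S(1)] b(1) b(2)[unfolded S(2) inf_j_component[OF S(1) U]]])
  obtain Y where Y: "finite Y" "Y \<subseteq> cls U ` T" "b \<sqsubseteq>\<^bsub>Q U\<^esub> \<Squnion>\<^bsub>Q U\<^esub>Y"
    by (rule Q.finite_sup_above[OF image_cls[OF T(1)] b(1) b(3)[unfolded T(2) sup_j_component[OF T(1) U]]])
  from finite_subset_image[OF X(1,2)] obtain S' where S': "S' \<subseteq> S" "finite S'" "X = cls U ` S'" by blast
  from finite_subset_image[OF Y(1,2)] obtain T' where T': "T' \<subseteq> T" "finite T'" "Y = cls U ` T'" by blast
  have SP: "S' \<subseteq> carrier P" "T' \<subseteq> carrier P" using S'(1) T'(1) S(1) T(1) by blast+
  note sP = inf_closed_P[OF S'(2) SP(1)] and tP = sup_closed_P[OF T'(2) SP(2)]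
  have X_closed: "\<Sqinter>\<^bsub>Q U\<^esub>X \<in> carrier (Q U)" "\<Squnion>\<^bsub>Q U\<^esub>Y \<in> carrier (Q U)"
    using greatest_closed[OF Q.L.finite_inf_glb[OF X(1)]] least_closed[OF Q.L.finite_sup_lub[OF Y(1)]]
      image_cls[OF SP(1)] image_cls[OF SP(2)] S'(3) T'(3) by blast+
  have "cls U (\<Sqinter>\<^bsub>P\<^esub>S') \<sqsubseteq>\<^bsub>Q U\<^esub> b"
    by (rule Q.L.le_trans[OF cls_inf_le[OF U S'(2) SP(1), folded S'(3)] X(3) cls_closed[OF sP] X_closed(1) b(1)])
  then have A1: "eventually (\<lambda>i. (\<Sqinter>\<^bsub>P\<^esub>S') i \<sqsubseteq>\<^bsub>L i\<^esub> a i) U"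
    unfolding a(2) cls_le_iff[OF U sP a(1)] .
  have "b \<sqsubseteq>\<^bsub>Q U\<^esub> cls U (\<Squnion>\<^bsub>P\<^esub>T')"
    by (rule Q.L.le_trans[OF Y(3) le_cls_sup[OF U T'(2) SP(2), folded T'(3)] b(1) X_closed(2) cls_closed[OF tP]])
  then have A2: "eventually (\<lambda>i. a i \<sqsubseteq>\<^bsub>L i\<^esub> (\<Squnion>\<^bsub>P\<^esub>T') i) U"
    unfolding a(2) cls_le_iff[OF U a(1) tP] .
  \<comment> \<open>On \<open>?A\<close> the representative \<open>a\<close> lies between finite
    bounds that are elements of \<open>P\<close>, so the glued element can be compared with
    \<open>p\<close> and \<open>q\<close> at every ultrafilter and not only at
    \<open>U\<close>.\<close>
  let ?A = "{i. (\<Sqinter>\<^bsub>P\<^esub>S') i \<sqsubseteq>\<^bsub>L i\<^esub> a i \<and> a i \<sqsubseteq>\<^bsub>L i\<^esub> (\<Squnion>\<^bsub>P\<^esub>T') i}"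
  have "eventually (\<lambda>i. i \<in> ?A) U" using eventually_conj[OF A1 A2] by simp
  then have "cls U (glue ?A a c) = b" unfolding cls_glue[OF U a(1) c(1)] a(2) by simp
  moreover have gP: "glue ?A a c \<in> carrier P" by (rule glue_closed[OF a(1) c(1)])
  moreover have p_le: "p \<sqsubseteq>\<^bsub>E\<^esub> j (\<Sqinter>\<^bsub>P\<^esub>S')"
  proof (rule E.le_e_finite_inf[OF S'(2) SP(1) pE])
    fix s assume "s \<in> S'"
    then have "j s \<in> j ` S" using S'(1) by blast
    then show "p \<sqsubseteq>\<^bsub>E\<^esub> j s" unfolding S(2) by (rule E.inf_lower[OF image_j[OF S(1)]])
  qed
  have q_ge: "j (\<Squnion>\<^bsub>P\<^esub>T') \<sqsubseteq>\<^bsub>E\<^esub> q"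
  proof (rule E.e_finite_sup_le[OF T'(2) SP(2) qE])
    fix t assume "t \<in> T'"
    then have "j t \<in> j ` T" using T'(1) by blast
    then show "j t \<sqsubseteq>\<^bsub>E\<^esub> q" unfolding T(2) by (rule E.sup_upper[OF image_j[OF T(1)]])
  qed
  \<comment> \<open>If \<open>?A\<close> is in \<open>V\<close>, the finite bounds apply, since
    \<open>p\<close> is below the lower one and \<open>q\<close> above the upper one at all
    coordinates; otherwise the glued element has the class of \<open>c\<close>.\<close>
  have "p V \<sqsubseteq>\<^bsub>D V\<^esub> j (glue ?A a c) V \<and> j (glue ?A a c) V \<sqsubseteq>\<^bsub>D V\<^esub> q V" if V: "V \<in> UF" for V
  proof (cases "eventually (\<lambda>i. i \<in> ?A) V")
    case True
    interpret V: dense_compact_completion "Q V" "D V" "d V" by (rule ultraproduct_completion[OF V])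
    have ja: "j (glue ?A a c) V = d V (cls V a)"
      using True by (simp add: j_component[OF V] cls_glue[OF V a(1) c(1)])
    have "cls V (\<Sqinter>\<^bsub>P\<^esub>S') \<sqsubseteq>\<^bsub>Q V\<^esub> cls V a" "cls V a \<sqsubseteq>\<^bsub>Q V\<^esub> cls V (\<Squnion>\<^bsub>P\<^esub>T')"
      unfolding cls_le_iff[OF V sP a(1)] cls_le_iff[OF V a(1) tP]
      by (rule eventually_mono[OF True], simp)+
    then have le: "j (\<Sqinter>\<^bsub>P\<^esub>S') V \<sqsubseteq>\<^bsub>D V\<^esub> d V (cls V a)" "d V (cls V a) \<sqsubseteq>\<^bsub>D V\<^esub> j (\<Squnion>\<^bsub>P\<^esub>T') V"
      unfolding j_component[OF V] V.e_le_iff[OF cls_closed[OF sP] cls_closed[OF a(1)]]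
        V.e_le_iff[OF cls_closed[OF a(1)] cls_closed[OF tP]] .
    have "p V \<sqsubseteq>\<^bsub>D V\<^esub> j (\<Sqinter>\<^bsub>P\<^esub>S') V" "j (\<Squnion>\<^bsub>P\<^esub>T') V \<sqsubseteq>\<^bsub>D V\<^esub> q V"
      using p_le q_ge V unfolding product_le_iff by simp_all
    with le show ?thesis
      using V.C.le_trans[OF _ le(1)] V.C.le_trans[OF le(2)] product_component[OF pE V]
        product_component[OF qE V] product_component[OF j_closed[OF sP] V]
        product_component[OF j_closed[OF tP] V] V.e_closed[OF cls_closed[OF a(1)]] unfolding ja by blast
  next
    case False
    then have "j (glue ?A a c) V = j c V"
      by (simp add: j_component[OF V] cls_glue[OF V a(1) c(1)])
    with c(2,3) V show ?thesis unfolding product_le_iff by simp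
  qed
  then have "p \<sqsubseteq>\<^bsub>E\<^esub> j (glue ?A a c)" "j (glue ?A a c) \<sqsubseteq>\<^bsub>E\<^esub> q" unfolding product_le_iff by blast+
  ultimately show ?thesis using gP by blast
qed

lemma interval_lifting_component:
  assumes U: "U \<in> UF"
  shows "interval_lifting P E j (Q U) (D U) (d U) (cls U) (\<lambda>x. x U)"
proof
  interpret Q: dense_compact_completion "Q U" "D U" "d U" by (rule ultraproduct_completion[OF U])
  show "j a \<in> carrier E" "cls U a \<in> carrier (Q U)" "j a U = d U (cls U a)" if "a \<in> carrier P" for a
    using j_closed[OF that] cls_closed[OF that] j_component[OF U] by blast+
  show "x U \<in> carrier (D U)" if "x \<in> carrier E" for x
    by (rule product_component[OF that U])
  show "p U \<in> closed_elements (Q U) (D U) (d U)" if "p \<in> closed_elements P E j" for p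
    by (rule closed_component[OF that U])
  show "q U \<in> open_elements (Q U) (D U) (d U)" if "q \<in> open_elements P E j" for q
    by (rule open_component[OF that U])
  show "p U \<sqsubseteq>\<^bsub>D U\<^esub> x U" if "p \<sqsubseteq>\<^bsub>E\<^esub> x" for p x
    using that U unfolding product_le_iff by (rule bspec)
  show "x U \<sqsubseteq>\<^bsub>D U\<^esub> q U" if "x \<sqsubseteq>\<^bsub>E\<^esub> q" for q x
    using that U unfolding product_le_iff by (rule bspec)
  \<comment> \<open>The lift agrees with \<open>p'\<close> at \<open>U\<close> and is the bottom
    elsewhere, hence below \<open>x\<close> whatever the other coordinates of \<open>x\<close>
    are.\<close>
  show "\<exists>p. p \<in> closed_elements P E j \<and> p \<sqsubseteq>\<^bsub>E\<^esub> x \<and> p U = p'"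
    if "x \<in> carrier E" "p' \<in> closed_elements (Q U) (D U) (d U)" "p' \<sqsubseteq>\<^bsub>D U\<^esub> x U" for x p'
    using closed_bump[OF U that(2)] bump_closed_le_iff[OF U that(1), of p'] that(3) U
    by (intro exI[of _ "\<lambda>V\<in>UF. if V = U then p' else \<bottom>\<^bsub>D V\<^esub>"]) simp
  show "\<exists>q. q \<in> open_elements P E j \<and> x \<sqsubseteq>\<^bsub>E\<^esub> q \<and> q U = q'"
    if "x \<in> carrier E" "q' \<in> open_elements (Q U) (D U) (d U)" "x U \<sqsubseteq>\<^bsub>D U\<^esub> q'" for x q'
    using open_bump[OF U that(2)] le_bump_open_iff[OF U that(1), of q'] that(3) U
    by (intro exI[of _ "\<lambda>V\<in>UF. if V = U then q' else \<top>\<^bsub>D V\<^esub>"]) simp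
  show "\<exists>a. a \<in> carrier P \<and> cls U a = b \<and> p \<sqsubseteq>\<^bsub>E\<^esub> j a \<and> j a \<sqsubseteq>\<^bsub>E\<^esub> q"
    if "x \<in> carrier E" "p \<in> closed_elements P E j" "q \<in> open_elements P E j" "p \<sqsubseteq>\<^bsub>E\<^esub> x" "x \<sqsubseteq>\<^bsub>E\<^esub> q"
      "b \<in> carrier (Q U)" "p U \<sqsubseteq>\<^bsub>D U\<^esub> d U b" "d U b \<sqsubseteq>\<^bsub>D U\<^esub> q U" for x p q b
    by (rule component_interpolation[OF U that(1,2,4,3,5-8)])
qed

text \<open>Uniqueness of completions yields \<open>h\<close> as an order isomorphism over
  \<open>P\<close>. That it respects the added operations is checked at each \<open>U\<close>,
  because \<open>h\<close> followed by evaluation at \<open>U\<close> still preserves all joins and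
  meets.\<close>

lemma canonical_extension_iso:
  assumes "canonical_extension F ar P C e"
  shows "\<exists>h. lba_iso F ar C E h"
proof -
  interpret C: canonical_extension F ar P C e by (fact assms)
  have C_dense: "dense_compact_completion P C e" by (rule canonical_extension.axioms[OF assms])
  have C_complete: "complete_lattice C" by (rule dense_compact_completion.axioms[OF C_dense])
  obtain h where h: "order_iso C E h" and h_e: "\<And>a. a \<in> carrier P \<Longrightarrow> h (e a) = j a"
    using dense_compact_completion_unique[OF C_dense E.dense_compact_completion_axioms] by blast
  have h_closed: "h x \<in> carrier E" if "x \<in> carrier C" for x
    using h that unfolding order_iso_def bij_betw_def by blast
  have "h (oper C f xs) = oper E f (map h xs)"
    if f: "f \<in> F" and xs: "xs \<in> carrier (power_lattice (ar f) C)" for f xs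
  proof -
    let ?n = "ar f"
    have oper_P: "oper P f as \<in> carrier P" if "as \<in> carrier (power_lattice ?n P)" for as
      by (rule lattice_based_algebra.oper_closed[OF product f that])
    have at_U: "h (oper C f xs) U = oper (D U) f (map (\<lambda>x. h x U) xs)" if U: "U \<in> UF" for U
    proof -
      interpret ext: canonical_extension F ar "Q U" "D U" "d U" by (rule extension[OF U])
      have "interval_lifting P C e (Q U) (D U) (d U) (cls U) (\<lambda>x. h x U)"
        by (rule interval_lifting_order_iso[OF interval_lifting_component[OF U] C_dense
              E.dense_compact_completion_axioms h h_e])
      then interpret lift: interval_lifting "power_lattice ?n P" "power_lattice ?n C" "map e"
        "power_lattice ?n (Q U)" "power_lattice ?n (D U)" "map (d U)" "map (cls U)" "map (\<lambda>x. h x U)"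
        by (rule interval_lifting_power[OF _ C_dense ultraproduct_completion[OF U]])
      have h_sup: "h (\<Squnion>\<^bsub>C\<^esub>A) U = \<Squnion>\<^bsub>D U\<^esub>((\<lambda>x. h x U) ` A)" if "A \<subseteq> carrier C" for A
        using order_iso_sup[OF C_complete E.complete_lattice_axioms h that]
          product_sup_component[where L = D, OF complete_D image_subsetI U, of A h] h_closed that
        by (simp add: image_image subset_iff)
      have h_inf: "h (\<Sqinter>\<^bsub>C\<^esub>A) U = \<Sqinter>\<^bsub>D U\<^esub>((\<lambda>x. h x U) ` A)" if "A \<subseteq> carrier C" for A
        using order_iso_inf[OF C_complete E.complete_lattice_axioms h that]
          product_inf_component[where L = D, OF complete_D image_subsetI U, of A h] h_closed that
        by (simp add: image_image subset_iff)
      have "h (sigma_extension (power_lattice ?n P) (power_lattice ?n C) (map e) C e (oper P f) xs) U =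
          sigma_extension (power_lattice ?n (Q U)) (power_lattice ?n (D U)) (map (d U)) (D U) (d U)
            (oper (Q U) f) (map (\<lambda>x. h x U) xs)"
      \<comment> \<open>Evaluation of \<open>h\<close> at \<open>U\<close> occurs twice: on each
        argument as the lifted map, and on the values as the map that preserves joins and
        meets.\<close>
      proof (rule lift.sigma_extension_transfer[OF xs C_complete, where h = "\<lambda>x. h x U"])
        fix as assume as: "as \<in> carrier (power_lattice ?n P)"
        show "e (oper P f as) \<in> carrier C"
          by (rule dense_compact_completion.e_closed[OF C_dense oper_P[OF as]])
        show "h (e (oper P f as)) U = d U (oper (Q U) f (map (cls U) as))"
          unfolding cls_oper[OF U f as] h_e[OF oper_P[OF as]] by (rule j_component[OF U])
      qed (rule h_sup h_inf, assumption)+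
      then show ?thesis
        unfolding C.oper_eq[OF f xs] ext.oper_eq[OF f lift.g_closed[OF xs]] .
    qed
    \<comment> \<open>Agreement at all ultrafilters gives equality only for extensional functions,
      so \<open>h\<close> must be applied to an element of \<open>C\<close>. As \<open>C\<close> is
      given as a complete lattice with a formula for its operations, closure of the carrier has to
      be read off that formula.\<close>
    have "oper C f xs \<in> carrier C"
    proof -
      have "e (oper P f as) \<in> carrier C" if "as \<in> carrier (power_lattice ?n P)" for as
        by (rule dense_compact_completion.e_closed[OF C_dense oper_P[OF that]])
      then show ?thesis
        unfolding C.oper_eq[OF f xs] sigma_extension_def
        by (intro C.C.sup_closed subsetI, elim CollectE exE conjE, hypsubst, intro C.C.inf_closed) blast
    qed
    then have "h (oper C f xs) \<in> extensional UF"
      using h_closed unfolding mem_carrier_product PiE_def by blast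
    then show ?thesis
      unfolding product_oper using at_U
      by (intro extensionalityI[where A = UF]) (simp_all add: comp_def)
  qed
  then have "lba_iso F ar C E h"
    using order_iso_bounded_lattice_hom[OF C_complete E.complete_lattice_axioms h] h
    unfolding lba_iso_def lba_hom_def order_iso_def by blast
  then show ?thesis by blast
qed

end

theorem theorem3p1:
  fixes I :: "'i set" and F :: "'f set" and ar :: "'f \<Rightarrow> nat"
    and L :: "'i \<Rightarrow> ('a, 'f) lba"
    and C :: "('c, 'f) lba" and e :: "('i \<Rightarrow> 'a) \<Rightarrow> 'c"
    and D :: "'i filter \<Rightarrow> ('d, 'f) lba" and d :: "'i filter \<Rightarrow> ('i \<Rightarrow> 'a) set \<Rightarrow> 'd"
  assumes "\<And>i. i \<in> I \<Longrightarrow> lattice_based_algebra F ar (L i)"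
    and "canonical_extension F ar (product_algebra I L) C e"
    and "\<And>U. U \<in> ultrafilters I \<Longrightarrow> canonical_extension F ar (ultraproduct I L U) (D U) (d U)"
  shows "\<exists>h. lba_iso F ar C (product_algebra (ultrafilters I) D) h"
proof -
  interpret ultraproduct_extensions I F ar L D d
    by (rule ultraproduct_extensions.intro[OF assms(1) canonical_extension.axioms(1)[OF assms(2)] assms(3)])
  from assms(2) show ?thesis by (rule canonical_extension_iso)
qed

end
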